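(* Let $n$ be a positive integer and $j\in\{1,\dots,n\}$, and let $X_j$ and $Y$ be Banach spaces with cotype $2$. Then $$\Pi_{q}(Y;Z)\circ\bigcup_{p\geq1}\delta_{p}^{n}(X_{1},\dots,X_{n};Y)\subset\Pi_{r}^{n}(X_{1},\dots,X_{n};Z)$$ for all $q\in[1,\infty)$, all $r\in[1,2]$ and all Banach spaces $X_{1},\dots,X_{j-1},X_{j+1},\dots,X_{n},Z$.
   Context: All Banach spaces are over $\mathbb{K}=\mathbb{R}$ or $\mathbb{C}$. For a Banach space $X$ with dual $X^*$ and $0<p<\infty$, $\ell_p(X)$ is the space of sequences $(x_j)$ in $X$ with $\sum_j\|x_j\|^p<\infty$, and $\ell_p^w(X)$ is the space of sequences $(x_j)$ in $X$ with $\sup_{\varphi\in B_{X^*}}\sum_j|\varphi(x_j)|^p<\infty$. For $1\le q<\infty$, $\Pi_q(Y;Z)$ is the set of absolutely $q$-summing linear operators: continuous linear $u:Y\to Z$ such that $(u(y_j))_j\in\ell_q(Z)$ whenever $(y_j)_j\in\ell_q^w(Y)$. If $0<p,q_1,\dots,q_n<\infty$ and $\frac1p\le\frac1{q_1}+\cdots+\frac1{q_n}$, a continuous $n$-linear operator $T:X_1\times\cdots\times X_n\to Y$ is absolutely $(p;q_1,\dots,q_n)$-summing, written $T\in\Pi_{(p;q_1,\dots,q_n)}^n(X_1,\dots,X_n;Y)$, if $(T(x_j^{(1)},\dots,x_j^{(n)}))_{j=1}^\infty\in\ell_p(Y)$ for all $(x_j^{(k)})_{j=1}^\infty\in\ell_{q_k}^w(X_k)$,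 $k=1,\dots,n$. Write $\Pi_r^n=\Pi_{(r;r,\dots,r)}^n$ and $\delta_p^n=\Pi_{(p/n;p,\dots,p)}^n$ (the $p$-dominated $n$-linear operators). For a set $\mathcal{A}$ of linear operators from $Y$ to $Z$ and a set $\mathcal{B}$ of $n$-linear operators into $Y$, $\mathcal{A}\circ\mathcal{B}=\{u\circ T: u\in\mathcal{A},\,T\in\mathcal{B}\}$. *)

theory Defs
  imports "HOL-Analysis.Analysis"
begin

text \<open>The scalar field is a type of the following class, whose members are exactly the fields
  of real and of complex numbers, up to isometric isomorphism over the reals.\<close>

class real_or_complex = real_normed_field +
  assumes real_or_complex:
    "(\<forall>z. \<exists>a. z = a *\<^sub>R 1) \<or>
     (\<exists>i. i * i = - 1 \<and> (\<forall>z. \<exists>a b. z = a *\<^sub>R 1 + b *\<^sub>R i) \<and>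
          (\<forall>a b. norm (a *\<^sub>R 1 + b *\<^sub>R i) = sqrt (a\<^sup>2 + b\<^sup>2)))"

instance real :: real_or_complex
  by standard simp

instance complex :: real_or_complex
proof
  have "z = Re z *\<^sub>R 1 + Im z *\<^sub>R \<i>" for z
    by (simp add: complex_eq_iff)
  moreover have "norm (a *\<^sub>R 1 + b *\<^sub>R \<i>) = sqrt (a\<^sup>2 + b\<^sup>2)" for a b
    by (simp add: cmod_def)
  moreover have "\<i> * \<i> = - 1"
    by simp
  ultimately show "(\<forall>z::complex. \<exists>a. z = a *\<^sub>R 1) \<or>
     (\<exists>i::complex. i * i = - 1 \<and> (\<forall>z. \<exists>a b. z = a *\<^sub>R 1 + b *\<^sub>R i) \<and>
          (\<forall>a b. norm (a *\<^sub>R 1 + b *\<^sub>R i) = sqrt (a\<^sup>2 + b\<^sup>2)))"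
    by blast
qed

text \<open>The type class of real normed spaces supplies addition, norm and real scaling; the
  scalar multiplication by \<open>'k\<close> is an explicit parameter extending the real one.
  A Banach space over \<open>'k\<close> is a type of class \<open>banach\<close> with such a multiplication, or a closed
  \<open>'k\<close>-linear subspace of one. Subspaces are used as carriers because the factors
  \<open>X 1, ..., X n\<close> of a product of varying length have to live in one type. This does not restrict
  the spaces: any Banach spaces \<open>X 1, ..., X n\<close> over \<open>'k\<close> are isometrically closed subspaces of
  their direct sum with the maximum norm.\<close>

locale normed_space_over = vector_space scale
  for scale :: "'k::real_or_complex \<Rightarrow> 'a::real_normed_vector \<Rightarrow> 'a" +
  assumes scale_of_real: "scale (of_real a) x = a *\<^sub>R x"
    and norm_scale: "norm (scale c x) = norm c * norm x"

definition banach_subspace ::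
    "('k::real_or_complex \<Rightarrow> 'a::banach \<Rightarrow> 'a) \<Rightarrow> 'a set \<Rightarrow> bool" where
  "banach_subspace s S \<longleftrightarrow> module.subspace s S \<and> closed S"

text \<open>The closed unit ball of the dual of the space \<open>S\<close> itself, not of the ambient type;
  the values of a functional outside \<open>S\<close> are irrelevant.\<close>

definition dual_ball ::
    "('k::real_or_complex \<Rightarrow> 'a::real_normed_vector \<Rightarrow> 'a) \<Rightarrow> 'a set \<Rightarrow> ('a \<Rightarrow> 'k) set" where
  "dual_ball s S = {\<phi>. (\<forall>x\<in>S. \<forall>y\<in>S. \<phi> (x + y) = \<phi> x + \<phi> y) \<and>
                       (\<forall>c. \<forall>x\<in>S. \<phi> (s c x) = c * \<phi> x) \<and>
                       (\<forall>x\<in>S. norm (\<phi> x) \<le> norm x)}"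

text \<open>The average over all choices of signs is the integral
  over \<open>[0,1]\<close> of \<open>norm (\<Sum>i. r\<^sub>i(t) x\<^sub>i)\<^sup>2\<close> with the Rademacher functions \<open>r\<^sub>i\<close>.\<close>

definition cotype :: "real \<Rightarrow> 'a::real_normed_vector set \<Rightarrow> bool" where
  "cotype q S \<longleftrightarrow>
     (\<exists>C\<ge>0. \<forall>(m::nat) x. (\<forall>i<m. x i \<in> S) \<longrightarrow>
        (\<Sum>i<m. norm (x i) powr q) powr (1 / q)
          \<le> C * sqrt ((\<Sum>\<epsilon>\<in>{..<m} \<rightarrow>\<^sub>E {- 1, 1}. (norm (\<Sum>i<m. \<epsilon> i *\<^sub>R x i))\<^sup>2) / 2 ^ m))"

definition lp_space :: "real \<Rightarrow> 'a::real_normed_vector set \<Rightarrow> (nat \<Rightarrow> 'a) set" where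
  "lp_space p S = {x. range x \<subseteq> S \<and> (\<Sum>j. ennreal (norm (x j) powr p)) < \<infinity>}"

definition weak_lp_space ::
    "real \<Rightarrow> ('k::real_or_complex \<Rightarrow> 'a::real_normed_vector \<Rightarrow> 'a) \<Rightarrow> 'a set \<Rightarrow> (nat \<Rightarrow> 'a) set" where
  "weak_lp_space p s S =
     {x. range x \<subseteq> S \<and> (SUP \<phi>\<in>dual_ball s S. \<Sum>j. ennreal (norm (\<phi> (x j)) powr p)) < \<infinity>}"

definition summing_linear ::
    "real \<Rightarrow> ('k::real_or_complex \<Rightarrow> 'y::banach \<Rightarrow> 'y) \<Rightarrow> ('k \<Rightarrow> 'z::banach \<Rightarrow> 'z) \<Rightarrow> ('y \<Rightarrow> 'z) set" where
  "summing_linear q sY sZ =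
     {u. Vector_Spaces.linear sY sZ u \<and> continuous_on UNIV u \<and>
         (\<forall>y\<in>weak_lp_space q sY UNIV. (\<lambda>j. u (y j)) \<in> lp_space q UNIV)}"

text \<open>An \<open>n\<close>-linear operator on \<open>X 1 \<times> ... \<times> X n\<close> is a function on \<open>\<Pi>\<^sub>E k\<in>{1..n}. X k\<close>;
  its values outside this set are irrelevant. Continuity is with respect to the product topology.\<close>

definition multilinear_operator ::
    "nat \<Rightarrow> ('k::real_or_complex \<Rightarrow> 'a::banach \<Rightarrow> 'a) \<Rightarrow> (nat \<Rightarrow> 'a set) \<Rightarrow>
     ('k \<Rightarrow> 'y::banach \<Rightarrow> 'y) \<Rightarrow> ((nat \<Rightarrow> 'a) \<Rightarrow> 'y) \<Rightarrow> bool" where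
  "multilinear_operator n sX X sY T \<longleftrightarrow>
     (\<forall>x\<in>\<Pi>\<^sub>E k\<in>{1..n}. X k. \<forall>k\<in>{1..n}.
        (\<forall>a\<in>X k. \<forall>b\<in>X k. T (x(k := a + b)) = T (x(k := a)) + T (x(k := b))) \<and>
        (\<forall>c. \<forall>a\<in>X k. T (x(k := sX c a)) = sY c (T (x(k := a))))) \<and>
     continuous_on (\<Pi>\<^sub>E k\<in>{1..n}. X k) T"

text \<open>The absolutely \<open>(p; q 1, ..., q n)\<close>-summing operators. The standing requirements
  \<open>0 < p\<close>, \<open>0 < q k\<close> and \<open>1 / p \<le> (\<Sum>k=1..n. 1 / q k)\<close> hold in both special cases below
  (for positive \<open>r\<close>, \<open>p\<close>, \<open>n\<close>).\<close>

definition summing_multilinear ::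
    "nat \<Rightarrow> real \<Rightarrow> (nat \<Rightarrow> real) \<Rightarrow> ('k::real_or_complex \<Rightarrow> 'a::banach \<Rightarrow> 'a) \<Rightarrow> (nat \<Rightarrow> 'a set) \<Rightarrow>
     ('k \<Rightarrow> 'y::banach \<Rightarrow> 'y) \<Rightarrow> ((nat \<Rightarrow> 'a) \<Rightarrow> 'y) set" where
  "summing_multilinear n p q sX X sY =
     {T. multilinear_operator n sX X sY T \<and>
         (\<forall>x. (\<forall>k\<in>{1..n}. x k \<in> weak_lp_space (q k) sX (X k)) \<longrightarrow>
              (\<lambda>j. T (\<lambda>k\<in>{1..n}. x k j)) \<in> lp_space p UNIV)}"

definition r_summing_multilinear ::
    "nat \<Rightarrow> real \<Rightarrow> ('k::real_or_complex \<Rightarrow> 'a::banach \<Rightarrow> 'a) \<Rightarrow> (nat \<Rightarrow> 'a set) \<Rightarrow>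
     ('k \<Rightarrow> 'y::banach \<Rightarrow> 'y) \<Rightarrow> ((nat \<Rightarrow> 'a) \<Rightarrow> 'y) set" where
  "r_summing_multilinear n r = summing_multilinear n r (\<lambda>_. r)"

definition dominated_multilinear ::
    "nat \<Rightarrow> real \<Rightarrow> ('k::real_or_complex \<Rightarrow> 'a::banach \<Rightarrow> 'a) \<Rightarrow> (nat \<Rightarrow> 'a set) \<Rightarrow>
     ('k \<Rightarrow> 'y::banach \<Rightarrow> 'y) \<Rightarrow> ((nat \<Rightarrow> 'a) \<Rightarrow> 'y) set" where
  "dominated_multilinear n p = summing_multilinear n (p / n) (\<lambda>_. p)"

definition compose_classes :: "('y \<Rightarrow> 'z) set \<Rightarrow> ('x \<Rightarrow> 'y) set \<Rightarrow> ('x \<Rightarrow> 'z) set" where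
  "compose_classes A B = {u \<circ> T | u T. u \<in> A \<and> T \<in> B}"

end

theory Submission
  imports Defs "HOL-Library.Function_Algebras"
begin

text \<open>Let \<open>T\<close> be \<open>p\<close>-dominated and \<open>u\<close> a bounded operator; the sums to be controlled are those of
\<open>\<parallel>T (x\<^sub>i\<^sup>1, \<dots>, x\<^sub>i\<^sup>n)\<parallel>\<^sup>r\<close> for weakly \<open>r\<close>-summable sequences, \<open>1 \<le> r \<le> 2\<close>. The proof has two halves, one for
each cotype assumption.

The cotype 2 of \<open>Y\<close> makes \<open>T\<close> multiple \<open>2\<close>-summing: the sum of \<open>\<parallel>T (x\<^sup>1 i\<^sub>1, \<dots>, x\<^sup>n i\<^sub>n)\<parallel>\<^sup>2\<close> over
all multi-indices is bounded when each \<open>x\<^sup>k\<close> has weak \<open>2\<close>-sums at most \<open>1\<close>. Applying cotype in one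
coordinate after the other bounds this sum by an average, over independent signs in every
coordinate, of \<open>\<parallel>T (\<Sum>i. \<epsilon>\<^sup>1 i x\<^sup>1 i, \<dots>, \<Sum>i. \<epsilon>\<^sup>n i x\<^sup>n i)\<parallel>\<^sup>2\<close>. The random sums, indexed by all sign patterns,
form a finite family whose weak \<open>q\<close>-sums are controlled by Khinchine's inequality, and \<open>T\<close> is
\<open>q\<close>-dominated for all \<open>q \<ge> p\<close>; a large \<open>q\<close> controls the average of the squares.

The cotype 2 of \<open>X j\<close> improves \<open>2\<close>-summability to \<open>r\<close>-summability in that coordinate. Fix the other
families and let \<open>N a\<close> be the \<open>\<ell>\<^sub>2\<close> norm of \<open>T\<close> with \<open>a\<close> in coordinate \<open>j\<close> and all multi-indices in the
others; then \<open>N\<close> is \<open>2\<close>-summing on \<open>X j\<close>. By Maurey's theorem (\<open>r_summing_of_two_summing\<close>) \<open>N\<close> is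
\<open>r\<close>-summing, and \<open>\<parallel>T (x\<^sub>i\<^sup>1, \<dots>, x\<^sub>i\<^sup>n)\<parallel> \<le> N (x\<^sub>i\<^sup>j)\<close>.

The core of Maurey's theorem is that a linear map \<open>w\<close> from a finite-dimensional \<open>\<ell>\<^sub>\<infinity>\<close> into a cotype 2
space is \<open>2\<close>-summing with a constant depending only on \<open>\<parallel>w\<parallel>\<close> and the cotype constant. If \<open>\<kappa>\<close> is a
\<open>2\<close>-summing constant of \<open>w\<close>, a Pietsch measure gives \<open>\<parallel>w f\<parallel>\<^sup>2 \<le> \<kappa> \<integral>f\<^sup>2\<close>. Truncating the random functions
\<open>\<Sum>j. \<epsilon> j f j\<close> at a large height, using \<open>\<parallel>w\<parallel>\<close> below the height and \<open>\<kappa>\<close> above it, where the fourth moment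
makes the contribution small, shows that a constant plus \<open>\<kappa> / 2\<close> is a \<open>2\<close>-summing constant as well.
Hence the best \<open>\<kappa>\<close> is at most twice that constant. For a weakly \<open>1\<close>-summable family \<open>x\<close> the density
of the Pietsch measure yields \<open>x i = \<surd>(l i) y i\<close> with \<open>\<Sum>i. l i = 1\<close> and weakly \<open>2\<close>-summable \<open>y\<close>, so that
the Cauchy-Schwarz inequality finishes the case \<open>r = 1\<close>; weighting the family by a power of \<open>N\<close> reduces
the other exponents to it.\<close>

section \<open>The Hahn-Banach theorem for sublinear functionals\<close>

text \<open>The scalar multiplication is a parameter, so that the Hahn-Banach theorem applies both to normed
spaces and to the pointwise operations on functions.\<close>

definition sublinear_wrt :: "(real \<Rightarrow> 'v::ab_group_add \<Rightarrow> 'v) \<Rightarrow> ('v \<Rightarrow> real) \<Rightarrow> bool" where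
  "sublinear_wrt s p \<longleftrightarrow> (\<forall>x y. p (x + y) \<le> p x + p y) \<and> (\<forall>t x. 0 \<le> t \<longrightarrow> p (s t x) = t * p x)"

lemma sublinear_zero:
  assumes "vector_space s" "sublinear_wrt s p" shows "p 0 = 0"
proof -
  interpret vector_space s by fact
  show ?thesis
    using assms(2) unfolding sublinear_wrt_def by (metis scale_zero_left mult_zero_left order_refl)
qed

lemma sublinear_lower:
  assumes "vector_space s" "sublinear_wrt s p" shows "- p (- x) \<le> p x"
  using assms(2) sublinear_zero[OF assms] unfolding sublinear_wrt_def
  by (metis add.right_inverse add_eq_0_iff2 diff_ge_0_iff_ge diff_minus_eq_add add.commute)

text \<open>This bounds chains from below in the application of Zorn's lemma. Directedness is needed for
subadditivity: values of two members at \<open>x\<close> and \<open>y\<close> are both bounded below by those of a single member.\<close>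

lemma sublinear_Inf:
  assumes s: "vector_space s" and C: "C \<noteq> {}" "\<And>g. g \<in> C \<Longrightarrow> sublinear_wrt s g"
    and le: "\<And>g x. g \<in> C \<Longrightarrow> g x \<le> p x"
    and direct: "\<And>g h. g \<in> C \<Longrightarrow> h \<in> C \<Longrightarrow> \<exists>k\<in>C. \<forall>x. k x \<le> g x \<and> k x \<le> h x"
  shows "sublinear_wrt s (\<lambda>x. INF g\<in>C. g x)" and "\<And>g x. g \<in> C \<Longrightarrow> (INF g\<in>C. g x) \<le> g x"
proof -
  have "- p (- x) \<le> g x" if "g \<in> C" for g x
    using sublinear_lower[OF s C(2)[OF that], of x] le[OF that, of "- x"] by linarith
  then have bdd: "bdd_below ((\<lambda>g. g x) ` C)" for x
    by (intro bdd_belowI2[where m = "- p (- x)"]) auto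
  show low: "(INF g\<in>C. g x) \<le> g x" if "g \<in> C" for g x
    using bdd that by (intro cINF_lower)
  have hom: "(INF g\<in>C. g (s t x)) \<le> t * (INF g\<in>C. g x)" if t: "0 \<le> t" for t x
  proof (cases "t = 0")
    case True
    obtain g where "g \<in> C" using C(1) by blast
    then show ?thesis
      using low[of g "s t x"] C(2)[of g] True unfolding sublinear_wrt_def by auto
  next
    case False
    then have "t > 0" using t by simp
    have "(INF g\<in>C. g (s t x)) / t \<le> (INF g\<in>C. g x)"
    proof (rule cINF_greatest[OF C(1)])
      fix g assume g: "g \<in> C"
      have "(INF g\<in>C. g (s t x)) \<le> t * g x"
        using low[OF g, of "s t x"] C(2)[OF g] t unfolding sublinear_wrt_def by auto
      then show "(INF g\<in>C. g (s t x)) / t \<le> g x"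
        using \<open>t > 0\<close> by (simp add: field_simps)
    qed
    then show ?thesis using \<open>t > 0\<close> by (simp add: field_simps)
  qed
  interpret vector_space s by fact
  show "sublinear_wrt s (\<lambda>x. INF g\<in>C. g x)"
    unfolding sublinear_wrt_def
  proof (intro conjI allI impI)
    fix x y
    have "(INF g\<in>C. g (x + y)) - (INF g\<in>C. g y) \<le> (INF g\<in>C. g x)"
    proof (rule cINF_greatest[OF C(1)])
      fix g assume g: "g \<in> C"
      have "(INF g\<in>C. g (x + y)) - g x \<le> (INF g\<in>C. g y)"
      proof (rule cINF_greatest[OF C(1)])
        fix h assume h: "h \<in> C"
        obtain k where k: "k \<in> C" "\<And>x. k x \<le> g x \<and> k x \<le> h x" using direct[OF g h] by blast
        have "k (x + y) \<le> k x + k y" using C(2)[OF k(1)] unfolding sublinear_wrt_def by blast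
        then show "(INF g\<in>C. g (x + y)) - g x \<le> h y"
          using low[OF k(1), of "x + y"] k(2)[of x] k(2)[of y] by linarith
      qed
      then show "(INF g\<in>C. g (x + y)) - (INF g\<in>C. g y) \<le> g x" by linarith
    qed
    then show "(INF g\<in>C. g (x + y)) \<le> (INF g\<in>C. g x) + (INF g\<in>C. g y)" by linarith
  next
    fix t :: real and x assume t: "0 \<le> t"
    show "(INF g\<in>C. g (s t x)) = t * (INF g\<in>C. g x)"
    proof (cases "t = 0")
      case True
      then have "(INF g\<in>C. g (s t x)) = (INF g\<in>C. 0)"
        using C(2) unfolding sublinear_wrt_def by (intro INF_cong refl) (metis mult_zero_left order_refl)
      then show ?thesis using True C(1) by simp
    next
      case False
      then have "(INF g\<in>C. g (s (1 / t) (s t x))) \<le> 1 / t * (INF g\<in>C. g (s t x))"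
        using t by (intro hom) auto
      then have "t * (INF g\<in>C. g x) \<le> (INF g\<in>C. g (s t x))"
        using False t by (simp add: field_simps)
      then show ?thesis using hom[OF t, of x] by simp
    qed
  qed
qed

text \<open>The witness is \<open>g x = INF t\<ge>0. p (x + t z) - t p z\<close>; the choice \<open>t = 1\<close> gives the value at \<open>- z\<close>.
It has two uses: a minimal sublinear functional must equal its \<open>g\<close> for every \<open>z\<close> and hence is odd, and for
\<open>p = norm\<close> every linear minorant of \<open>g\<close> attains the norm at \<open>z\<close>.\<close>

lemma sublinear_directional:
  assumes s: "vector_space s" and p: "sublinear_wrt s p"
  shows "\<exists>g. sublinear_wrt s g \<and> (\<forall>x. g x \<le> p x) \<and> g (- z) \<le> - p z"
proof -
  interpret vector_space s by fact
  have add: "p (x + y) \<le> p x + p y" for x y using p unfolding sublinear_wrt_def by blast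
  have sc: "p (s t x) = t * p x" if "0 \<le> t" for t x using p that unfolding sublinear_wrt_def by blast
  define g where "g = (\<lambda>x. INF t\<in>{0..}. p (x + s t z) - t * p z)"
  have "- p (- x) \<le> p (x + s t z) - t * p z" if "t \<in> {0..}" for x t
    using add[of "x + s t z" "- x"] sc[of t z] that by simp
  then have bdd: "bdd_below ((\<lambda>t. p (x + s t z) - t * p z) ` {0..})" for x
    by (intro bdd_belowI2[where m = "- p (- x)"])
  have low: "g x \<le> p (x + s t z) - t * p z" if "0 \<le> t" for x t
    unfolding g_def using bdd that by (intro cINF_lower) auto
  have great: "c \<le> g x" if "\<And>t. 0 \<le> t \<Longrightarrow> c \<le> p (x + s t z) - t * p z" for c x
    unfolding g_def using that by (intro cINF_greatest) auto
  have hom: "t * g x \<le> g (s t x)" if t: "0 < t" for t x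
  proof (rule great)
    fix a :: real assume a: "0 \<le> a"
    have "t * g x \<le> t * (p (x + s (a / t) z) - a / t * p z)"
      using low[of "a / t" x] a t by (intro mult_left_mono) auto
    also have "\<dots> = p (s t (x + s (a / t) z)) - a * p z"
      using sc[of t "x + s (a / t) z"] t by (simp add: algebra_simps)
    also have "s t (x + s (a / t) z) = s t x + s a z"
      using t by (simp add: scale_right_distrib)
    finally show "t * g x \<le> p (s t x + s a z) - a * p z" .
  qed
  have "sublinear_wrt s g"
    unfolding sublinear_wrt_def
  proof (intro conjI allI impI)
    fix x y
    have "g (x + y) - g x \<le> g y"
    proof (rule great)
      fix b :: real assume b: "0 \<le> b"
      have "g (x + y) - (p (y + s b z) - b * p z) \<le> g x"
      proof (rule great)
        fix a :: real assume a: "0 \<le> a"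
        have "p ((x + y) + s (a + b) z) \<le> p (x + s a z) + p (y + s b z)"
          using add[of "x + s a z" "y + s b z"] by (simp add: scale_left_distrib algebra_simps)
        then show "g (x + y) - (p (y + s b z) - b * p z) \<le> p (x + s a z) - a * p z"
          using low[of "a + b" "x + y"] a b by (simp add: algebra_simps)
      qed
      then show "g (x + y) - g x \<le> p (y + s b z) - b * p z" by linarith
    qed
    then show "g (x + y) \<le> g x + g y" by linarith
  next
    fix t :: real and x assume t: "0 \<le> t"
    have g0: "g 0 = 0"
    proof (rule antisym)
      show "g 0 \<le> 0" using low[of 0 0] sublinear_zero[OF s p] by simp
      show "0 \<le> g 0" by (rule great) (simp add: sc)
    qed
    show "g (s t x) = t * g x"
    proof (cases "t = 0")
      case False
      then have "1 / t * g (s t x) \<le> g (s (1 / t) (s t x))" using t by (intro hom) auto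
      then show ?thesis using hom[of t x] t False by (simp add: field_simps)
    qed (simp add: g0)
  qed
  moreover have "g x \<le> p x" for x using low[of 0 x] by simp
  moreover have "g (- z) \<le> - p z" using low[of 1 "- z"] sublinear_zero[OF s p] by simp
  ultimately show ?thesis by blast
qed

text \<open>Zorn's lemma provides a minimal sublinear functional below \<open>p\<close>, and a minimal one is odd, hence
linear.\<close>

lemma hahn_banach_sublinear:
  assumes s: "vector_space s" and p: "sublinear_wrt s p"
  shows "\<exists>f. (\<forall>x y. f (x + y) = f x + f y) \<and> (\<forall>t x. f (s t x) = t * f x) \<and> (\<forall>x. f x \<le> p x)"
proof -
  interpret vector_space s by fact
  define A where "A = {g. sublinear_wrt s g \<and> (\<forall>x. g x \<le> p x)}"
  define P where "P = (\<lambda>g h :: 'a \<Rightarrow> real. \<forall>x. h x \<le> g x)"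
  have "\<exists>m\<in>A. \<forall>a\<in>A. P m a \<longrightarrow> a = m"
  proof (rule predicate_Zorn)
    show "partial_order_on A (relation_of P A)"
      by (rule partial_order_on_relation_ofI) (auto simp: P_def fun_eq_iff intro: order_trans antisym)
    fix C assume C: "C \<in> Chains (relation_of P A)"
    have CA: "C \<subseteq> A" using C by (auto simp: Chains_def relation_of_def)
    show "\<exists>u\<in>A. \<forall>a\<in>C. P a u"
    proof (cases "C = {}")
      case True
      then show ?thesis using p by (auto simp: A_def)
    next
      case False
      have dir: "\<exists>k\<in>C. \<forall>x. k x \<le> g x \<and> k x \<le> h x" if "g \<in> C" "h \<in> C" for g h
        using C that unfolding Chains_def relation_of_def P_def by (smt (verit) mem_Collect_eq case_prodD)
      have sub: "\<And>g. g \<in> C \<Longrightarrow> sublinear_wrt s g" and le: "\<And>g x. g \<in> C \<Longrightarrow> g x \<le> p x"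
        using CA by (auto simp: A_def)
      have inf: "sublinear_wrt s (\<lambda>x. INF g\<in>C. g x)" "\<And>g x. g \<in> C \<Longrightarrow> (INF g\<in>C. g x) \<le> g x"
        by (rule sublinear_Inf[OF s False, where p = p]; use sub le dir in blast)+
      obtain g where "g \<in> C" using False by blast
      then have "(INF g\<in>C. g x) \<le> p x" for x
        using inf(2)[of g x] le[of g x] by linarith
      then have "(\<lambda>x. INF g\<in>C. g x) \<in> A" using inf(1) by (simp add: A_def)
      then show ?thesis using inf(2) by (auto simp: P_def intro!: bexI)
    qed
  qed
  then obtain m where m: "m \<in> A" and min: "\<And>a. a \<in> A \<Longrightarrow> P m a \<Longrightarrow> a = m" by blast
  have sm: "sublinear_wrt s m" and mp: "\<And>x. m x \<le> p x" using m by (auto simp: A_def)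
  have odd: "m (- z) = - m z" for z
  proof -
    obtain g where g: "sublinear_wrt s g" "\<And>x. g x \<le> m x" "g (- z) \<le> - m z"
      using sublinear_directional[OF s sm] by blast
    then have "g = m" using min[of g] mp by (auto simp: A_def P_def intro: order_trans)
    then show ?thesis using g(3) sublinear_lower[OF s sm, of "- z"] by simp
  qed
  have add: "m (x + y) \<le> m x + m y" for x y using sm unfolding sublinear_wrt_def by blast
  have "m (x + y) = m x + m y" for x y
    using add[of x y] add[of "x + y" "- y"] odd[of y] by simp
  moreover have "m (s t x) = t * m x" for t x
  proof (cases "0 \<le> t")
    case True
    then show ?thesis using sm unfolding sublinear_wrt_def by blast
  next
    case False
    then have "m (s (- t) x) = - t * m x" using sm unfolding sublinear_wrt_def by (metis less_eq_real_def linear neg_0_le_iff_le)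
    then show ?thesis using odd[of "s t x"] by (simp add: scale_minus_left)
  qed
  ultimately show ?thesis using mp by blast
qed

section \<open>Scalars, norming functionals and weak sums\<close>

text \<open>Real and imaginary part on an abstract scalar field; in the real case the imaginary part is zero.
The identity for the norm transfers Khinchine's inequality and Hilbert space duality from real
coefficients.\<close>

lemma scalar_parts:
  "\<exists>re im :: 'k::real_or_complex \<Rightarrow> real. linear re \<and> linear im \<and> (\<forall>z. (norm z)\<^sup>2 = (re z)\<^sup>2 + (im z)\<^sup>2)"
  using real_or_complex[where 'a = 'k]
proof
  assume "\<forall>z::'k. \<exists>a. z = a *\<^sub>R 1"
  then obtain re where re: "\<And>z::'k. z = re z *\<^sub>R 1" by metis
  have "linear re"
  proof (rule linearI)
    show "re (x + y) = re x + re y" for x y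
      using re[of x] re[of y] re[of "x + y"] by (metis scaleR_cancel_right scaleR_left_distrib zero_neq_one)
    show "re (r *\<^sub>R x) = r *\<^sub>R re x" for r x
      using re[of x] re[of "r *\<^sub>R x"] by (metis scaleR_cancel_right scaleR_scaleR real_scaleR_def zero_neq_one)
  qed
  moreover have "(norm z)\<^sup>2 = (re z)\<^sup>2" for z
    by (subst re[of z]) simp
  ultimately show ?thesis
    by (intro exI[of _ re] exI[of _ "\<lambda>_. 0"]) (auto intro!: linearI)
next
  assume "\<exists>i::'k. i * i = - 1 \<and> (\<forall>z. \<exists>a b. z = a *\<^sub>R 1 + b *\<^sub>R i) \<and>
          (\<forall>a b. norm (a *\<^sub>R 1 + b *\<^sub>R i) = sqrt (a\<^sup>2 + b\<^sup>2))"
  then obtain i :: 'k where ex: "\<And>z. \<exists>a b. z = a *\<^sub>R 1 + b *\<^sub>R i"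
    and n: "\<And>a b. norm (a *\<^sub>R 1 + b *\<^sub>R i) = sqrt (a\<^sup>2 + b\<^sup>2)" by blast
  obtain re im where z: "\<And>z. z = re z *\<^sub>R 1 + im z *\<^sub>R i" using ex by metis
  have uniq: "a = c \<and> b = d" if "a *\<^sub>R 1 + b *\<^sub>R i = c *\<^sub>R 1 + d *\<^sub>R i" for a b c d
  proof -
    have "(a - c) *\<^sub>R 1 + (b - d) *\<^sub>R i = 0" using that by (simp add: algebra_simps)
    then have "sqrt ((a - c)\<^sup>2 + (b - d)\<^sup>2) = 0" using n[of "a - c" "b - d"] by simp
    then show ?thesis by (simp add: sum_power2_eq_zero_iff)
  qed
  have add: "re (x + y) = re x + re y \<and> im (x + y) = im x + im y" for x y
  proof (rule uniq)
    have "x + y = (re x *\<^sub>R 1 + im x *\<^sub>R i) + (re y *\<^sub>R 1 + im y *\<^sub>R i)" using z[of x] z[of y] by simp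
    then show "re (x + y) *\<^sub>R 1 + im (x + y) *\<^sub>R i = (re x + re y) *\<^sub>R 1 + (im x + im y) *\<^sub>R i"
      using z[of "x + y"] by (simp add: algebra_simps)
  qed
  have scale: "re (r *\<^sub>R x) = r * re x \<and> im (r *\<^sub>R x) = r * im x" for r x
  proof (rule uniq)
    have "r *\<^sub>R x = r *\<^sub>R (re x *\<^sub>R 1 + im x *\<^sub>R i)" using z[of x] by simp
    then show "re (r *\<^sub>R x) *\<^sub>R 1 + im (r *\<^sub>R x) *\<^sub>R i = (r * re x) *\<^sub>R 1 + (r * im x) *\<^sub>R i"
      using z[of "r *\<^sub>R x"] by (simp add: algebra_simps)
  qed
  have "(norm x)\<^sup>2 = (re x)\<^sup>2 + (im x)\<^sup>2" for x
    by (subst z[of x]) (simp add: n)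
  moreover have "linear re" "linear im" using add scale by (auto intro!: linearI)
  ultimately show ?thesis by blast
qed

lemma real_norming_functional:
  fixes z :: "'a::real_normed_vector"
  shows "\<exists>f. linear f \<and> (\<forall>x. f x \<le> norm x) \<and> f z = norm z"
proof -
  have "sublinear_wrt scaleR (norm :: 'a \<Rightarrow> real)"
    by (auto simp: sublinear_wrt_def norm_triangle_ineq)
  then obtain g where g: "sublinear_wrt scaleR g" "\<And>x. g x \<le> norm x" "g (- z) \<le> - norm z"
    using sublinear_directional[OF real_vector.vector_space_axioms] by blast
  obtain f where f: "\<And>x y. f (x + y) = f x + f y" "\<And>t x. f (t *\<^sub>R x) = t * f x" "\<And>x. f x \<le> g x"
    using hahn_banach_sublinear[OF real_vector.vector_space_axioms g(1)] by blast
  have "linear f" using f by (auto intro!: linearI)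
  moreover have le: "f x \<le> norm x" for x using f(3)[of x] g(2)[of x] by linarith
  moreover have "f (- z) = - f z" using \<open>linear f\<close> by (rule linear_neg)
  then have "norm z \<le> f z" using f(3)[of "- z"] g(3) by linarith
  ultimately show ?thesis using le[of z] by (intro exI[of _ f]) auto
qed

text \<open>The functional is obtained on the whole ambient space, which serves every carrier \<open>S\<close>. Over the
complex numbers the real functional \<open>f\<close> is completed to \<open>f x - f (\<i> x) \<i>\<close>; its modulus at \<open>x\<close> is
estimated by testing \<open>f\<close> on the multiple of \<open>x\<close> that rotates this value to the real axis.\<close>

lemma norming_functional:
  fixes s :: "'k::real_or_complex \<Rightarrow> 'a::real_normed_vector \<Rightarrow> 'a"
  assumes "normed_space_over s"
  shows "\<exists>\<phi>\<in>dual_ball s S. norm z \<le> norm (\<phi> z)"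
proof -
  interpret normed_space_over s by fact
  obtain f where f: "linear f" "\<And>x. f x \<le> norm x" "f z = norm z"
    using real_norming_functional by blast
  have fabs: "\<bar>f x\<bar> \<le> norm x" for x
    using f(2)[of x] f(2)[of "- x"] linear_neg[OF f(1), of x] by simp
  have fadd: "f (x + y) = f x + f y" and fsc: "f (a *\<^sub>R x) = a * f x" for a x y
    using f(1) by (auto simp: linear_add linear_scale)
  from real_or_complex[where 'a = 'k] show ?thesis
  proof
    assume real: "\<forall>z::'k. \<exists>a. z = a *\<^sub>R 1"
    define \<phi> where "\<phi> x = (of_real (f x) :: 'k)" for x
    have "\<phi> (s c x) = c * \<phi> x" for c x
    proof -
      obtain a where "c = of_real a" using real by (metis of_real_def)
      then show ?thesis by (simp add: \<phi>_def scale_of_real fsc)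
    qed
    then have "\<phi> \<in> dual_ball s S" by (simp add: dual_ball_def \<phi>_def fadd fabs)
    moreover have "norm z \<le> norm (\<phi> z)" using f(3) by (simp add: \<phi>_def)
    ultimately show ?thesis by blast
  next
    assume "\<exists>i::'k. i * i = - 1 \<and> (\<forall>z. \<exists>a b. z = a *\<^sub>R 1 + b *\<^sub>R i) \<and>
          (\<forall>a b. norm (a *\<^sub>R 1 + b *\<^sub>R i) = sqrt (a\<^sup>2 + b\<^sup>2))"
    then obtain i :: 'k where i: "i * i = - 1" and ex: "\<And>z. \<exists>a b. z = a *\<^sub>R 1 + b *\<^sub>R i"
      and n: "\<And>a b. norm (a *\<^sub>R 1 + b *\<^sub>R i) = sqrt (a\<^sup>2 + b\<^sup>2)" by blast
    have ex': "\<exists>a b. c = of_real a + of_real b * i" for c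
      using ex[of c] by (simp add: scaleR_conv_of_real)
    have n': "norm (of_real a + of_real b * i) = sqrt (a\<^sup>2 + b\<^sup>2)" for a b
      using n[of a b] by (simp add: scaleR_conv_of_real)
    define g where "g x = f (s i x)" for x
    define \<phi> where "\<phi> x = (of_real (f x) - of_real (g x) * i :: 'k)" for x
    have fsc2: "f (s (of_real a + of_real b * i) x) = a * f x + b * g x" for a b x
      by (simp add: scale_left_distrib fadd scale_of_real fsc g_def flip: scale_scale)
    have hom: "\<phi> (s c x) = c * \<phi> x" for c x
    proof -
      obtain a b where c: "c = of_real a + of_real b * i" using ex' by blast
      have ic: "i * c = of_real (- b) + of_real a * i"
        unfolding c using i by (simp add: distrib_left mult.left_commute[of i])
      have "g (s c x) = f (s (i * c) x)" by (simp add: g_def)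
      also have "\<dots> = a * g x - b * f x" unfolding ic using fsc2[of "- b" a x] by simp
      finally have gc: "g (s c x) = a * g x - b * f x" .
      have "\<phi> (s c x) = of_real (a * f x + b * g x) - of_real (a * g x - b * f x) * i"
        by (simp only: \<phi>_def gc) (simp only: c fsc2)
      also have "\<dots> = of_real a * of_real (f x) + of_real b * of_real (g x)
          - of_real a * of_real (g x) * i + of_real b * of_real (f x) * i"
        by (simp add: algebra_simps)
      also have "\<dots> = of_real a * of_real (f x) - of_real b * of_real (g x) * (i * i)
          - of_real a * of_real (g x) * i + of_real b * of_real (f x) * i"
        unfolding i by simp
      also have "\<dots> = c * \<phi> x" by (simp add: c \<phi>_def algebra_simps)
      finally show ?thesis .
    qed
    have norm_\<phi>: "norm (\<phi> x) = sqrt ((f x)\<^sup>2 + (g x)\<^sup>2)" for x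
      using n'[of "f x" "- g x"] by (simp add: \<phi>_def)
    have "norm (\<phi> x) \<le> norm x" for x
    proof -
      let ?N = "sqrt ((f x)\<^sup>2 + (g x)\<^sup>2)"
      have "?N * ?N = f (s (of_real (f x) + of_real (g x) * i) x)"
        unfolding fsc2 by (simp add: power2_eq_square)
      also have "\<dots> \<le> norm (s (of_real (f x) + of_real (g x) * i) x)" by (rule f(2))
      also have "\<dots> = ?N * norm x" by (simp add: norm_scale n')
      finally have "?N * ?N \<le> ?N * norm x" .
      moreover have "N \<le> b" if "N * N \<le> N * b" "0 \<le> N" "0 \<le> b" for N b :: real
        using that by (cases "N = 0") (auto simp: mult_le_cancel_left)
      ultimately have "?N \<le> norm x" by (metis norm_ge_zero real_sqrt_ge_zero sum_power2_ge_zero)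
      then show ?thesis by (simp add: norm_\<phi>)
    qed
    moreover have "\<phi> (x + y) = \<phi> x + \<phi> y" for x y
      by (simp add: \<phi>_def g_def fadd scale_right_distrib algebra_simps)
    ultimately have "\<phi> \<in> dual_ball s S" by (simp add: dual_ball_def hom)
    moreover have "norm z \<le> norm (\<phi> z)"
      unfolding norm_\<phi> f(3) by (simp add: real_le_rsqrt)
    ultimately show ?thesis by blast
  qed
qed

lemma dual_ball_sum:
  assumes "normed_space_over s" "subspace S" "\<phi> \<in> dual_ball s S"
    and "finite I" "\<And>i. i \<in> I \<Longrightarrow> x i \<in> S"
  shows "\<phi> (\<Sum>i\<in>I. a i *\<^sub>R x i) = (\<Sum>i\<in>I. a i *\<^sub>R \<phi> (x i))"
proof -
  interpret normed_space_over s by fact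
  have add: "\<phi> (x + y) = \<phi> x + \<phi> y" if "x \<in> S" "y \<in> S" for x y
    using assms(3) that by (auto simp: dual_ball_def)
  have sc: "\<phi> (t *\<^sub>R x) = t *\<^sub>R \<phi> x" if "x \<in> S" for x t
    using assms(3) that scale_of_real[of t x, symmetric] by (auto simp: dual_ball_def scaleR_conv_of_real)
  have "\<phi> 0 = 0" using sc[of 0 0] real_vector.subspace_0[OF assms(2)] by simp
  with assms(4,5) show ?thesis
  proof (induction I rule: finite_induct)
    case (insert i I)
    then show ?case
      using assms(2) by (simp add: add sc real_vector.subspace_sum real_vector.subspace_scale)
  qed simp
qed

definition weak_sum_le ::
    "('k::real_or_complex \<Rightarrow> 'a::real_normed_vector \<Rightarrow> 'a) \<Rightarrow> 'a set \<Rightarrow> real \<Rightarrow> 'i set \<Rightarrow> ('i \<Rightarrow> 'a) \<Rightarrow> real \<Rightarrow> bool" where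
  "weak_sum_le s S p I x W \<longleftrightarrow> (\<forall>\<phi>\<in>dual_ball s S. (\<Sum>i\<in>I. norm (\<phi> (x i)) powr p) \<le> W)"

text \<open>A weakly \<open>1\<close>-summable family defines a bounded operator on \<open>\<ell>\<^sub>\<infinity>\<close>.\<close>

lemma norm_sum_le_weak_sum:
  assumes s: "normed_space_over s" "subspace S" and I: "finite I" "\<And>i. i \<in> I \<Longrightarrow> x i \<in> S"
    and W: "weak_sum_le s S 1 I x W" and a: "\<And>i. i \<in> I \<Longrightarrow> \<bar>a i\<bar> \<le> t" and t: "0 \<le> t"
  shows "norm (\<Sum>i\<in>I. a i *\<^sub>R x i) \<le> t * W"
proof -
  obtain \<phi> where \<phi>: "\<phi> \<in> dual_ball s S" "norm (\<Sum>i\<in>I. a i *\<^sub>R x i) \<le> norm (\<phi> (\<Sum>i\<in>I. a i *\<^sub>R x i))"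
    using norming_functional[OF s(1)] by blast
  note \<phi>(2)
  also have "norm (\<phi> (\<Sum>i\<in>I. a i *\<^sub>R x i)) = norm (\<Sum>i\<in>I. a i *\<^sub>R \<phi> (x i))"
    by (simp add: dual_ball_sum[OF s \<phi>(1) I])
  also have "\<dots> \<le> (\<Sum>i\<in>I. t * norm (\<phi> (x i)))"
    by (rule sum_norm_le) (auto intro!: mult_right_mono a)
  also have "\<dots> = t * (\<Sum>i\<in>I. norm (\<phi> (x i)) powr 1)" by (simp add: sum_distrib_left)
  also have "\<dots> \<le> t * W" using W \<phi>(1) t by (intro mult_left_mono) (auto simp: weak_sum_le_def)
  finally show ?thesis .
qed

text \<open>By duality: for a functional \<open>\<phi>\<close> take as coefficients \<open>b\<close> the real parts of the \<open>\<phi> (y i)\<close>, and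
then the imaginary parts. Each part contributes \<open>K\<close>.\<close>

lemma weak_sum_le_of_l2_bound:
  fixes s :: "'k::real_or_complex \<Rightarrow> 'a::real_normed_vector \<Rightarrow> 'a"
  assumes s: "normed_space_over s" "subspace S" and I: "finite I" "\<And>i. i \<in> I \<Longrightarrow> y i \<in> S" and K0: "0 \<le> K"
    and K: "\<And>b. (norm (\<Sum>i\<in>I. b i *\<^sub>R y i))\<^sup>2 \<le> K * (\<Sum>i\<in>I. (b i)\<^sup>2)"
  shows "weak_sum_le s S 2 I y (2 * K)"
  unfolding weak_sum_le_def
proof
  fix \<phi> assume \<phi>: "\<phi> \<in> dual_ball s S"
  obtain re im :: "'k \<Rightarrow> real" where lin: "linear re" "linear im"
    and norm: "\<And>z. (norm z)\<^sup>2 = (re z)\<^sup>2 + (im z)\<^sup>2" using scalar_parts by blast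
  have part: "(\<Sum>i\<in>I. (h (\<phi> (y i)))\<^sup>2) \<le> K" if h: "linear h" "\<And>z. (h z)\<^sup>2 \<le> (norm z)\<^sup>2" for h
  proof -
    define b where "b i = h (\<phi> (y i))" for i
    define B where "B = (\<Sum>i\<in>I. (b i)\<^sup>2)"
    have S: "(\<Sum>i\<in>I. b i *\<^sub>R y i) \<in> S" using I s(2) by (intro subspace_sum subspace_scale) auto
    have "B = h (\<phi> (\<Sum>i\<in>I. b i *\<^sub>R y i))"
      by (simp add: dual_ball_sum[OF s \<phi> I] linear_sum[OF h(1)] linear_scale[OF h(1)] B_def b_def power2_eq_square)
    then have "B\<^sup>2 \<le> (norm (\<phi> (\<Sum>i\<in>I. b i *\<^sub>R y i)))\<^sup>2" using h(2) by simp
    also have "\<dots> \<le> (norm (\<Sum>i\<in>I. b i *\<^sub>R y i))\<^sup>2"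
      using \<phi> S by (intro power_mono) (auto simp: dual_ball_def)
    also have "\<dots> \<le> K * B" unfolding B_def by (rule K)
    finally have "B * B \<le> K * B" by (simp add: power2_eq_square)
    moreover have "B \<ge> 0" unfolding B_def by (intro sum_nonneg) auto
    ultimately show ?thesis
      using K0 unfolding B_def[symmetric] b_def[symmetric] by (cases "B = 0") (auto simp: mult_le_cancel_right)
  qed
  have "(\<Sum>i\<in>I. norm (\<phi> (y i)) powr 2) = (\<Sum>i\<in>I. (re (\<phi> (y i)))\<^sup>2) + (\<Sum>i\<in>I. (im (\<phi> (y i)))\<^sup>2)"
    by (simp add: norm sum.distrib)
  also have "\<dots> \<le> K + K" by (intro add_mono part lin) (auto simp: norm)
  finally show "(\<Sum>i\<in>I. norm (\<phi> (y i)) powr 2) \<le> 2 * K" by simp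
qed

section \<open>Separation of a convex cone from the negative orthant\<close>

lemma sum_fun_apply: "(\<Sum>i\<in>I. F i) x = (\<Sum>i\<in>I. F i x)"
  by (induction I rule: infinite_finite_induct) auto

text \<open>A convex cone of functions on a finite set without everywhere negative members is nonnegative under
some probability weight. The functional \<open>p h = INF g\<in>C. Max (h + g)\<close> is sublinear; a linear functional
below it is monotone and maps the constant \<open>1\<close> to \<open>1\<close>, so it is such a weight, and since \<open>p (- g) \<le> 0\<close> for
\<open>g\<close> in the cone it is nonnegative there.\<close>

lemma cone_separation:
  fixes C :: "('i \<Rightarrow> real) set"
  assumes I: "finite I" "I \<noteq> {}"
    and zero: "0 \<in> C"
    and add: "\<And>g h. g \<in> C \<Longrightarrow> h \<in> C \<Longrightarrow> g + h \<in> C"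
    and scale: "\<And>t g. 0 \<le> t \<Longrightarrow> g \<in> C \<Longrightarrow> (\<lambda>i. t * g i) \<in> C"
    and nonneg: "\<And>g. g \<in> C \<Longrightarrow> \<exists>i\<in>I. 0 \<le> g i"
  shows "\<exists>l. (\<forall>i\<in>I. 0 \<le> l i) \<and> (\<Sum>i\<in>I. l i) = 1 \<and> (\<forall>g\<in>C. 0 \<le> (\<Sum>i\<in>I. l i * g i))"
proof -
  define s where "s = (\<lambda>t h. \<lambda>i::'i. t * h i :: real)"
  have vs: "vector_space s"
    by unfold_locales (auto simp: s_def fun_eq_iff algebra_simps)
  define M where "M h = Max (h ` I)" for h :: "'i \<Rightarrow> real"
  have Mge: "h i \<le> M h" if "i \<in> I" for h i
    unfolding M_def using I that by (intro Max_ge) auto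
  have Mle: "M h \<le> c" if "\<And>i. i \<in> I \<Longrightarrow> h i \<le> c" for h c
    unfolding M_def using I that by (intro Max.boundedI) auto
  define p where "p h = (INF g\<in>C. M (h + g))" for h
  have "- M (- h) \<le> M (h + g)" if g: "g \<in> C" for h g
  proof -
    obtain i where "i \<in> I" "0 \<le> g i" using nonneg[OF g] by blast
    then show ?thesis using Mge[of i "h + g"] Mge[of i "- h"] by simp
  qed
  then have bdd: "bdd_below ((\<lambda>g. M (h + g)) ` C)" for h
    by (intro bdd_belowI2[where m = "- M (- h)"])
  have low: "p h \<le> M (h + g)" if "g \<in> C" for h g
    unfolding p_def using bdd that by (intro cINF_lower)
  have great: "c \<le> p h" if "\<And>g. g \<in> C \<Longrightarrow> c \<le> M (h + g)" for c h
    unfolding p_def using zero that by (intro cINF_greatest) auto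
  have hom: "t * p h \<le> p (s t h)" if t: "0 < t" for t h
  proof (rule great)
    fix g assume g: "g \<in> C"
    have "p h \<le> M (h + s (1 / t) g)" using scale[of "1 / t" g] t g by (intro low) (simp add: s_def)
    also have "\<dots> \<le> M (s t h + g) / t"
    proof (rule Mle)
      fix i assume "i \<in> I"
      then have "(s t h + g) i / t \<le> M (s t h + g) / t"
        using t by (intro divide_right_mono Mge) auto
      then show "(h + s (1 / t) g) i \<le> M (s t h + g) / t"
        using t by (simp add: s_def add_divide_distrib)
    qed
    finally show "t * p h \<le> M (s t h + g)" using t by (simp add: field_simps)
  qed
  have p0: "p 0 = 0"
  proof (rule antisym)
    show "p 0 \<le> 0" using low[OF zero, of 0] Mle[of 0 0] by simp
    show "0 \<le> p 0"
    proof (rule great)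
      fix g assume "g \<in> C"
      then obtain i where "i \<in> I" "0 \<le> g i" using nonneg by blast
      then show "0 \<le> M (0 + g)" using Mge[of i g] by simp
    qed
  qed
  have "sublinear_wrt s p"
    unfolding sublinear_wrt_def
  proof (intro conjI allI impI)
    fix h k
    have "p (h + k) - p h \<le> p k"
    proof (rule great)
      fix g assume g: "g \<in> C"
      have "p (h + k) - M (k + g) \<le> p h"
      proof (rule great)
        fix f assume f: "f \<in> C"
        have "p (h + k) \<le> M ((h + k) + (f + g))" by (intro low add f g)
        also have "\<dots> \<le> M (h + f) + M (k + g)"
        proof (rule Mle)
          fix i assume "i \<in> I"
          then show "(h + k + (f + g)) i \<le> M (h + f) + M (k + g)"
            using Mge[of i "h + f"] Mge[of i "k + g"] by simp
        qed
        finally show "p (h + k) - M (k + g) \<le> M (h + f)" by simp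
      qed
      then show "p (h + k) - p h \<le> M (k + g)" by simp
    qed
    then show "p (h + k) \<le> p h + p k" by simp
  next
    fix t :: real and h assume t: "0 \<le> t"
    show "p (s t h) = t * p h"
    proof (cases "t = 0")
      case True
      then have "s t h = 0" by (simp add: s_def fun_eq_iff)
      then show ?thesis using True p0 by simp
    next
      case False
      have "1 / t * p (s t h) \<le> p (s (1 / t) (s t h))" using t False by (intro hom) auto
      moreover have "s (1 / t) (s t h) = h" using False by (simp add: s_def)
      ultimately show ?thesis using hom[of t h] t False by (simp add: field_simps)
    qed
  qed
  then obtain f where fadd: "\<And>x y. f (x + y) = f x + f y" and fs: "\<And>t x. f (s t x) = t * f x"
    and fp: "\<And>x. f x \<le> p x"
    using hahn_banach_sublinear[OF vs] by blast
  have f0: "f 0 = 0" using fadd[of 0 0] by simp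
  have fneg: "f (- h) = - f h" for h using fadd[of h "- h"] f0 by simp
  define e where "e i = (\<lambda>j. if j = i then 1 else 0 :: real)" for i :: 'i
  define l where "l i = f (e i)" for i
  have fM: "f h \<le> M h" for h using fp[of h] low[OF zero, of h] by simp
  have fsum: "f (\<Sum>i\<in>J. F i) = (\<Sum>i\<in>J. f (F i))" if "finite J" for J :: "'i set" and F
    using that by (induction J rule: finite_induct) (simp_all only: sum.insert sum.empty fadd f0 simp_thms)
  have rep: "f h = (\<Sum>i\<in>I. l i * h i)" for h
  proof -
    have agree: "f k \<le> f h" if "\<And>i. i \<in> I \<Longrightarrow> h i = k i" for h k
    proof -
      have "f (k - h) \<le> 0" using fM[of "k - h"] Mle[of "k - h" 0] that by fastforce
      then show ?thesis using fadd[of "k - h" h] by simp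
    qed
    have "f h = f (\<Sum>i\<in>I. s (h i) (e i))"
      by (intro antisym agree) (auto simp: sum_fun_apply s_def e_def if_distrib I cong: if_cong)
    then show ?thesis by (simp add: fsum I fs l_def mult.commute)
  qed
  have "0 \<le> l i" if "i \<in> I" for i
  proof -
    have "M (- e i) \<le> 0" by (rule Mle) (simp add: e_def)
    then show ?thesis using fM[of "- e i"] by (simp add: fneg l_def)
  qed
  moreover have "(\<Sum>i\<in>I. l i) = 1"
    using fM[of 1] Mle[of 1 1] fM[of "- 1"] Mle[of "- 1" "- 1"] fneg[of 1] by (simp add: rep)
  moreover have "0 \<le> (\<Sum>i\<in>I. l i * g i)" if "g \<in> C" for g
    using fp[of "- g"] low[OF that, of "- g"] Mle[of 0 0] by (simp add: fneg flip: rep)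
  ultimately show ?thesis by blast
qed

section \<open>Khinchine's inequality for even exponents\<close>

definition signs :: "nat \<Rightarrow> (nat \<Rightarrow> real) set" where
  "signs m = {..<m} \<rightarrow>\<^sub>E {- 1, 1}"

lemma finite_signs [simp]: "finite (signs m)"
  by (simp add: signs_def finite_PiE)

lemma card_signs [simp]: "card (signs m) = 2 ^ m"
  by (simp add: signs_def card_PiE card_insert_if numeral_2_eq_2)

text \<open>The second-order Taylor expansion gives this for \<open>\<bar>x\<bar> \<le> 1\<close>; otherwise \<open>\<bar>x\<bar> \<le> 2 x\<^sup>2\<close>.\<close>

lemma exp_plus_exp_minus_le: "exp x + exp (- x) \<le> 2 * exp (2 * x\<^sup>2)" for x :: real
proof (cases "\<bar>x\<bar> \<le> 1")
  case True
  have ub: "exp y \<le> 1 + y + 2 * y\<^sup>2" if y: "\<bar>y\<bar> \<le> 1" for y :: real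
  proof -
    obtain t where t: "\<bar>t\<bar> \<le> \<bar>y\<bar>" "exp y = (\<Sum>m<2. y ^ m / fact m) + exp t / fact 2 * y ^ 2"
      using Maclaurin_exp_le[of y 2] by blast
    have "exp t \<le> exp 1" using t(1) y by simp
    also have "\<dots> \<le> 3" by (rule exp_le)
    finally have "exp t * y\<^sup>2 \<le> 3 * y\<^sup>2" by (intro mult_right_mono) auto
    moreover have "exp y = 1 + y + exp t * y\<^sup>2 / 2"
      using t(2) by (simp add: eval_nat_numeral)
    ultimately show ?thesis by (smt (verit) zero_le_power2 field_sum_of_halves)
  qed
  have "exp x + exp (- x) \<le> 2 * (1 + 2 * x\<^sup>2)" using ub[of x] ub[of "- x"] True by simp
  also have "\<dots> \<le> 2 * exp (2 * x\<^sup>2)" by (intro mult_left_mono exp_ge_add_one_self) auto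
  finally show ?thesis .
next
  case False
  then have "\<bar>x\<bar> * 1 \<le> \<bar>x\<bar> * \<bar>x\<bar>" by (intro mult_left_mono) auto
  then have "\<bar>x\<bar> \<le> 2 * x\<^sup>2" by (simp add: power2_eq_square)
  then have "exp x \<le> exp (2 * x\<^sup>2)" "exp (- x) \<le> exp (2 * x\<^sup>2)" by auto
  then show ?thesis unfolding mult_2[of "exp _"] by (rule add_mono)
qed

lemma power_le_fact_exp: "y ^ n \<le> fact n * exp y" if "0 \<le> y" for y :: real
proof -
  have "y ^ n /\<^sub>R fact n = (\<Sum>k\<in>{n}. y ^ k /\<^sub>R fact k)" by simp
  also have "\<dots> \<le> (\<Sum>k. y ^ k /\<^sub>R fact k)"
    using that by (intro sum_le_suminf summable_exp_generic) auto
  also have "\<dots> = exp y" by (simp add: exp_def)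
  finally show ?thesis by (simp add: field_simps)
qed

text \<open>Independence of the signs: the exponential moment of a Rademacher sum factorises.\<close>

lemma sum_signs_exp_le: "(\<Sum>\<epsilon>\<in>signs m. exp (\<Sum>i<m. \<epsilon> i * a i)) \<le> 2 ^ m * exp (2 * (\<Sum>i<m. (a i)\<^sup>2))"
proof -
  have "(\<Sum>\<epsilon>\<in>signs m. exp (\<Sum>i<m. \<epsilon> i * a i)) = (\<Sum>\<epsilon>\<in>signs m. \<Prod>i<m. exp (\<epsilon> i * a i))"
    by (simp add: exp_sum)
  also have "\<dots> = (\<Prod>i<m. \<Sum>e\<in>{- 1, 1}. exp (e * a i))"
    unfolding signs_def by (rule prod_sum_PiE[symmetric]) auto
  also have "\<dots> \<le> (\<Prod>i<m. 2 * exp (2 * (a i)\<^sup>2))"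
    using exp_plus_exp_minus_le by (intro prod_mono) (auto simp: add.commute)
  also have "\<dots> = 2 ^ m * exp (2 * (\<Sum>i<m. (a i)\<^sup>2))"
    by (simp add: prod.distrib exp_sum sum_distrib_left)
  finally show ?thesis .
qed

definition khinchine_const :: "nat \<Rightarrow> real" where
  "khinchine_const k = fact (2 * k) * 2 * exp 2"

text \<open>A power is dominated by an exponential, and the exponential moments of a Rademacher sum with
square sum at most \<open>1\<close> are bounded.\<close>

lemma khinchine:
  assumes k: "1 \<le> k" and M: "(\<Sum>i<m. (a i)\<^sup>2) \<le> M"
  shows "(\<Sum>\<epsilon>\<in>signs m. (\<Sum>i<m. \<epsilon> i * a i) ^ (2 * k)) \<le> khinchine_const k * 2 ^ m * M ^ k"
proof -
  have unit: "(\<Sum>\<epsilon>\<in>signs m. (\<Sum>i<m. \<epsilon> i * b i) ^ (2 * k)) \<le> khinchine_const k * 2 ^ m"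
    if b: "(\<Sum>i<m. (b i)\<^sup>2) \<le> 1" for b
  proof -
    have "(\<Sum>i<m. \<epsilon> i * b i) ^ (2 * k)
        \<le> fact (2 * k) * (exp (\<Sum>i<m. \<epsilon> i * b i) + exp (\<Sum>i<m. \<epsilon> i * - b i))" for \<epsilon> :: "nat \<Rightarrow> real"
    proof -
      let ?S = "\<Sum>i<m. \<epsilon> i * b i"
      have "?S ^ (2 * k) = \<bar>?S\<bar> ^ (2 * k)" by (simp add: power_even_abs)
      also have "\<dots> \<le> fact (2 * k) * exp \<bar>?S\<bar>" by (rule power_le_fact_exp) simp
      also have "\<dots> \<le> fact (2 * k) * (exp ?S + exp (- ?S))"
        by (intro mult_left_mono) (auto simp: abs_if)
      finally show ?thesis by (simp add: sum_negf)
    qed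
    then have "(\<Sum>\<epsilon>\<in>signs m. (\<Sum>i<m. \<epsilon> i * b i) ^ (2 * k))
        \<le> (\<Sum>\<epsilon>\<in>signs m. fact (2 * k) * (exp (\<Sum>i<m. \<epsilon> i * b i) + exp (\<Sum>i<m. \<epsilon> i * - b i)))"
      by (intro sum_mono)
    also have "\<dots> = fact (2 * k) * ((\<Sum>\<epsilon>\<in>signs m. exp (\<Sum>i<m. \<epsilon> i * b i))
                                 + (\<Sum>\<epsilon>\<in>signs m. exp (\<Sum>i<m. \<epsilon> i * - b i)))"
      by (simp only: sum_distrib_left sum.distrib distrib_left)
    also have "\<dots> \<le> fact (2 * k) * (2 ^ m * exp 2 + 2 ^ m * exp 2)"
    proof (intro mult_left_mono add_mono)
      have "2 ^ m * exp (2 * (\<Sum>i<m. (b i)\<^sup>2)) \<le> 2 ^ m * exp 2" using b by simp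
      moreover note sum_signs_exp_le[where m = m and a = b]
      moreover have "(\<Sum>\<epsilon>\<in>signs m. exp (\<Sum>i<m. \<epsilon> i * - b i)) \<le> 2 ^ m * exp (2 * (\<Sum>i<m. (b i)\<^sup>2))"
        using sum_signs_exp_le[where m = m and a = "\<lambda>i. - b i"] by simp
      ultimately show "(\<Sum>\<epsilon>\<in>signs m. exp (\<Sum>i<m. \<epsilon> i * b i)) \<le> 2 ^ m * exp 2"
        "(\<Sum>\<epsilon>\<in>signs m. exp (\<Sum>i<m. \<epsilon> i * - b i)) \<le> 2 ^ m * exp 2"
        by linarith+
    qed simp
    finally show ?thesis by (simp add: khinchine_const_def)
  qed
  have "0 \<le> (\<Sum>i<m. (a i)\<^sup>2)" by (intro sum_nonneg) auto
  show ?thesis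
  proof (cases "M = 0")
    case True
    then have "(\<Sum>i<m. (a i)\<^sup>2) = 0" using M \<open>0 \<le> _\<close> by simp
    then have "a i = 0" if "i < m" for i using that by (subst (asm) sum_nonneg_eq_0_iff) auto
    then show ?thesis using k True by (simp add: power_0_left)
  next
    case False
    then have M0: "0 < M" using M \<open>0 \<le> _\<close> by linarith
    define b where "b i = a i / sqrt M" for i
    have "(\<Sum>i<m. (b i)\<^sup>2) = (\<Sum>i<m. (a i)\<^sup>2) / M"
      using M0 by (simp add: b_def power_divide sum_divide_distrib)
    also have "\<dots> \<le> 1" using M M0 by simp
    finally have "(\<Sum>\<epsilon>\<in>signs m. (\<Sum>i<m. \<epsilon> i * b i) ^ (2 * k)) \<le> khinchine_const k * 2 ^ m" by (rule unit)
    moreover have "(\<Sum>i<m. \<epsilon> i * b i) ^ (2 * k) = (\<Sum>i<m. \<epsilon> i * a i) ^ (2 * k) / M ^ k" for \<epsilon> :: "nat \<Rightarrow> real"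
    proof -
      have "(\<Sum>i<m. \<epsilon> i * b i) = (\<Sum>i<m. \<epsilon> i * a i) / sqrt M"
        by (simp add: b_def sum_divide_distrib)
      moreover have "sqrt M ^ (2 * k) = M ^ k" using M0 by (simp add: power_mult)
      ultimately show ?thesis by (simp add: power_divide)
    qed
    ultimately have "(\<Sum>\<epsilon>\<in>signs m. (\<Sum>i<m. \<epsilon> i * a i) ^ (2 * k)) / M ^ k \<le> khinchine_const k * 2 ^ m"
      by (simp add: sum_divide_distrib)
    then show ?thesis using M0 by (simp add: pos_divide_le_eq)
  qed
qed

section \<open>Operators from finite-dimensional sup-norm spaces into cotype 2 spaces\<close>

lemma cotype_2E:
  assumes "cotype 2 S"
  obtains C where "0 < C" and "\<And>m x. (\<And>i. i < m \<Longrightarrow> x i \<in> S) \<Longrightarrow>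
    (\<Sum>i<m. (norm (x i))\<^sup>2) \<le> C / 2 ^ m * (\<Sum>\<epsilon>\<in>signs m. (norm (\<Sum>i<m. \<epsilon> i *\<^sub>R x i))\<^sup>2)"
proof -
  obtain C where C: "0 \<le> C" and ineq: "\<And>m x. (\<forall>i<m. x i \<in> S) \<Longrightarrow> (\<Sum>i<m. norm (x i) powr 2) powr (1 / 2)
          \<le> C * sqrt ((\<Sum>\<epsilon>\<in>{..<m} \<rightarrow>\<^sub>E {- 1, 1}. (norm (\<Sum>i<m. \<epsilon> i *\<^sub>R x i))\<^sup>2) / 2 ^ m)"
    using assms unfolding cotype_def by blast
  have "(\<Sum>i<m. (norm (x i))\<^sup>2) \<le> (C\<^sup>2 + 1) / 2 ^ m * (\<Sum>\<epsilon>\<in>signs m. (norm (\<Sum>i<m. \<epsilon> i *\<^sub>R x i))\<^sup>2)"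
    if "\<And>i. i < m \<Longrightarrow> x i \<in> S" for m x
  proof -
    let ?E = "\<Sum>\<epsilon>\<in>signs m. (norm (\<Sum>i<m. \<epsilon> i *\<^sub>R x i))\<^sup>2"
    have E: "0 \<le> ?E" by (intro sum_nonneg) auto
    have "sqrt (\<Sum>i<m. (norm (x i))\<^sup>2) \<le> C * sqrt (?E / 2 ^ m)"
      using ineq[of m x] that by (simp add: signs_def powr_half_sqrt sum_nonneg)
    then have "(sqrt (\<Sum>i<m. (norm (x i))\<^sup>2))\<^sup>2 \<le> (C * sqrt (?E / 2 ^ m))\<^sup>2"
      by (intro power_mono) (auto simp: sum_nonneg)
    then have "(\<Sum>i<m. (norm (x i))\<^sup>2) \<le> C\<^sup>2 * (?E / 2 ^ m)"
      using E by (simp add: power_mult_distrib sum_nonneg)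
    also have "\<dots> \<le> (C\<^sup>2 + 1) * (?E / 2 ^ m)"
      using E by (intro mult_right_mono) auto
    finally show ?thesis by simp
  qed
  moreover have "0 < C\<^sup>2 + 1" by (simp add: add_nonneg_pos)
  ultimately show ?thesis using that by blast
qed

text \<open>\<open>\<kappa>\<close> bounds the square of the \<open>2\<close>-summing norm of \<open>w\<close> on \<open>\<ell>\<^sub>\<infinity>\<close> of dimension \<open>m\<close>, since the weak
\<open>2\<close>-sums of a family \<open>fs\<close> in this space are governed by the point evaluations. Families are lists because the
cone in Pietsch's theorem is closed under concatenation of families.\<close>

definition two_summing_le :: "nat \<Rightarrow> ((nat \<Rightarrow> real) \<Rightarrow> 'a::real_normed_vector) \<Rightarrow> real \<Rightarrow> bool" where
  "two_summing_le m w \<kappa> \<longleftrightarrow>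
     (\<forall>fs M. (\<forall>i<m. (\<Sum>f\<leftarrow>fs. (f i)\<^sup>2) \<le> M) \<longrightarrow> (\<Sum>f\<leftarrow>fs. (norm (w f))\<^sup>2) \<le> \<kappa> * M)"

text \<open>Pietsch's domination theorem on a finite set: the functions \<open>\<kappa> \<Sum>f\<^sup>2 - \<Sum>\<parallel>w f\<parallel>\<^sup>2\<close>, one for each family of
\<open>f\<close>, form a convex cone. None of them is negative everywhere, by the \<open>2\<close>-summing inequality applied with
the maximum of \<open>\<Sum>f\<^sup>2\<close>; the weight that separates the cone is the Pietsch measure.\<close>

lemma pietsch_domination_linf:
  assumes m: "0 < m"
    and hom: "\<And>t f. norm (w (\<lambda>i. t * f i)) = \<bar>t\<bar> * norm (w f)"
    and \<kappa>: "two_summing_le m w \<kappa>"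
  shows "\<exists>l. (\<forall>i<m. 0 \<le> l i) \<and> (\<Sum>i<m. l i) = 1 \<and> (\<forall>f. (norm (w f))\<^sup>2 \<le> \<kappa> * (\<Sum>i<m. l i * (f i)\<^sup>2))"
proof -
  define G where "G fs = (\<lambda>i. \<kappa> * (\<Sum>f\<leftarrow>fs. (f i)\<^sup>2) - (\<Sum>f\<leftarrow>fs. (norm (w f))\<^sup>2))" for fs
  have "\<exists>l. (\<forall>i\<in>{..<m}. 0 \<le> l i) \<and> (\<Sum>i<m. l i) = 1 \<and> (\<forall>g\<in>range G. 0 \<le> (\<Sum>i<m. l i * g i))"
  proof (rule cone_separation)
    show "{..<m} \<noteq> {}" using m by auto
    show "0 \<in> range G" by (rule range_eqI[of _ _ "[]"]) (simp add: G_def fun_eq_iff)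
    show "g + h \<in> range G" if gh: "g \<in> range G" "h \<in> range G" for g h
    proof -
      obtain fs hs where "g = G fs" "h = G hs" using gh by blast
      moreover have "G fs + G hs = G (fs @ hs)" by (simp add: G_def fun_eq_iff algebra_simps)
      ultimately show ?thesis by blast
    qed
    show "(\<lambda>i. t * g i) \<in> range G" if t: "0 \<le> t" and g: "g \<in> range G" for t g
    proof -
      obtain fs where "g = G fs" using g by blast
      then have "(\<lambda>i. t * g i) = G (map (\<lambda>f i. sqrt t * f i) fs)"
        using t by (simp add: G_def fun_eq_iff hom power_mult_distrib o_def sum_list_const_mult right_diff_distrib)
      then show ?thesis by blast
    qed
    show "\<exists>i\<in>{..<m}. 0 \<le> g i" if g: "g \<in> range G" for g
    proof -
      obtain fs where fs: "g = G fs" using g by blast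
      define v where "v i = (\<Sum>f\<leftarrow>fs. (f i)\<^sup>2)" for i
      have "Max (v ` {..<m}) \<in> v ` {..<m}" using m by (intro Max_in) auto
      then obtain i where i: "i < m" "v i = Max (v ` {..<m})" by force
      then have "v k \<le> v i" if "k < m" for k using that by (simp add: Max_ge)
      then have "(\<Sum>f\<leftarrow>fs. (norm (w f))\<^sup>2) \<le> \<kappa> * v i"
        using \<kappa> unfolding two_summing_le_def v_def by blast
      then show ?thesis using i(1) by (auto simp: fs G_def v_def)
    qed
  qed simp
  then obtain l where l: "\<forall>i<m. 0 \<le> l i" "(\<Sum>i<m. l i) = 1" "\<And>fs. 0 \<le> (\<Sum>i<m. l i * G fs i)" by auto
  have "(norm (w f))\<^sup>2 \<le> \<kappa> * (\<Sum>i<m. l i * (f i)\<^sup>2)" for f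
  proof -
    have "(\<Sum>i<m. l i * G [f] i) = \<kappa> * (\<Sum>i<m. l i * (f i)\<^sup>2) - (\<Sum>i<m. l i) * (norm (w f))\<^sup>2"
      by (simp add: G_def right_diff_distrib sum_subtractf sum_distrib_left sum_distrib_right mult.left_commute)
    then show ?thesis using l(2) l(3)[of "[f]"] by simp
  qed
  then show ?thesis using l by blast
qed

text \<open>\<open>W\<close> bounds the norm of the operator that maps the unit vectors of \<open>\<ell>\<^sub>\<infinity>\<close> to the \<open>x i\<close>.\<close>

locale linf_into_cotype_2 =
  fixes m :: nat and x :: "nat \<Rightarrow> 'a::real_normed_vector" and S :: "'a set" and C W :: real
  assumes m: "0 < m" and S: "subspace S" and x: "\<And>i. i < m \<Longrightarrow> x i \<in> S"
    and C: "0 < C"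
    and cotype: "\<And>l y. (\<And>i. i < l \<Longrightarrow> y i \<in> S) \<Longrightarrow>
      (\<Sum>i<l. (norm (y i))\<^sup>2) \<le> C / 2 ^ l * (\<Sum>\<epsilon>\<in>signs l. (norm (\<Sum>i<l. \<epsilon> i *\<^sub>R y i))\<^sup>2)"
    and W: "\<And>a t. (\<And>i. i < m \<Longrightarrow> \<bar>a i\<bar> \<le> t) \<Longrightarrow> 0 \<le> t \<Longrightarrow> norm (\<Sum>i<m. a i *\<^sub>R x i) \<le> t * W"
begin

definition w :: "(nat \<Rightarrow> real) \<Rightarrow> 'a" where "w a = (\<Sum>i<m. a i *\<^sub>R x i)"

lemma norm_w_scale: "norm (w (\<lambda>i. t * f i)) = \<bar>t\<bar> * norm (w f)"
  by (simp add: w_def flip: scaleR_scaleR scaleR_sum_right)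

text \<open>A bound that depends on the dimension; it ensures that a best constant exists.\<close>

lemma two_summing_le_trivial: "two_summing_le m w (W\<^sup>2 * m)"
  unfolding two_summing_le_def
proof (intro allI impI)
  fix fs :: "(nat \<Rightarrow> real) list" and M
  assume M: "\<forall>i<m. (\<Sum>f\<leftarrow>fs. (f i)\<^sup>2) \<le> M"
  have "(norm (w f))\<^sup>2 \<le> W\<^sup>2 * (\<Sum>i<m. (f i)\<^sup>2)" for f
  proof -
    have "\<bar>f i\<bar> \<le> sqrt (\<Sum>i<m. (f i)\<^sup>2)" if "i < m" for i
      using that by (intro real_le_rsqrt) (auto intro: member_le_sum)
    then have "norm (w f) \<le> sqrt (\<Sum>i<m. (f i)\<^sup>2) * W"
      unfolding w_def by (intro W) (auto simp: sum_nonneg)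
    then have "(norm (w f))\<^sup>2 \<le> (sqrt (\<Sum>i<m. (f i)\<^sup>2) * W)\<^sup>2" by (intro power_mono) auto
    then show ?thesis by (simp add: power_mult_distrib sum_nonneg mult.commute)
  qed
  then have "(\<Sum>f\<leftarrow>fs. (norm (w f))\<^sup>2) \<le> (\<Sum>f\<leftarrow>fs. W\<^sup>2 * (\<Sum>i<m. (f i)\<^sup>2))" by (intro sum_list_mono)
  also have "\<dots> = W\<^sup>2 * (\<Sum>i<m. \<Sum>f\<leftarrow>fs. (f i)\<^sup>2)"
    by (induction fs) (simp_all add: distrib_left sum.distrib)
  also have "\<dots> \<le> W\<^sup>2 * (\<Sum>i<m. M)" using M by (intro mult_left_mono sum_mono) auto
  finally show "(\<Sum>f\<leftarrow>fs. (norm (w f))\<^sup>2) \<le> W\<^sup>2 * m * M" by simp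
qed

text \<open>The self-improvement of a \<open>2\<close>-summing constant. Cotype bounds \<open>\<Sum>\<parallel>w f\<parallel>\<^sup>2\<close> by the average of
\<open>\<parallel>w (\<Sum>j. \<epsilon> j f j)\<parallel>\<^sup>2\<close>. Split each random function where its square exceeds \<open>\<tau> M\<close>: the bounded part costs at
most \<open>\<tau> M W\<^sup>2\<close>, and the large part is at most its fourth power over \<open>\<tau> M\<close> in the Pietsch measure, which
Khinchine's inequality bounds on average by a multiple of \<open>M / \<tau>\<close>.\<close>

lemma two_summing_le_improve:
  assumes \<kappa>: "two_summing_le m w \<kappa>" and \<kappa>0: "0 \<le> \<kappa>"
  shows "two_summing_le m w (8 * C\<^sup>2 * khinchine_const 2 * W\<^sup>2 + \<kappa> / 2)"
  unfolding two_summing_le_def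
proof (intro allI impI)
  fix fs :: "(nat \<Rightarrow> real) list" and M
  assume M: "\<forall>i<m. (\<Sum>f\<leftarrow>fs. (f i)\<^sup>2) \<le> M"
  obtain l where l: "\<And>i. i < m \<Longrightarrow> 0 \<le> l i" "(\<Sum>i<m. l i) = 1"
    and dom: "\<And>f. (norm (w f))\<^sup>2 \<le> \<kappa> * (\<Sum>i<m. l i * (f i)\<^sup>2)"
    using pietsch_domination_linf[OF m norm_w_scale \<kappa>] by blast
  let ?K = "khinchine_const 2"
  have K: "0 < ?K" by (simp add: khinchine_const_def)
  (* This choice makes the coefficient of \<kappa> equal to 1/2. *)
  define \<tau> where "\<tau> = 4 * C * ?K"
  have \<tau>: "0 < \<tau>" using C K by (simp add: \<tau>_def)
  define L where "L = length fs"
  define F where "F \<epsilon> i = (\<Sum>j<L. \<epsilon> j * (fs ! j) i)" for \<epsilon> i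
  have nth: "(\<Sum>f\<leftarrow>fs. h f) = (\<Sum>j<L. h (fs ! j))" for h :: "_ \<Rightarrow> real"
    by (simp add: sum_list_sum_nth L_def atLeast0LessThan)
  have M0: "0 \<le> M"
    using M m by (metis (no_types, lifting) nth order_trans sum_nonneg zero_le_power2)
  show "(\<Sum>f\<leftarrow>fs. (norm (w f))\<^sup>2) \<le> (8 * C\<^sup>2 * ?K * W\<^sup>2 + \<kappa> / 2) * M"
  proof (cases "M = 0")
    case True
    have "w (fs ! j) = 0" if j: "j < L" for j
    proof -
      have "(fs ! j) i = 0" if i: "i < m" for i
      proof -
        have "((fs ! j) i)\<^sup>2 \<le> (\<Sum>j<L. ((fs ! j) i)\<^sup>2)" using j by (intro member_le_sum) auto
        also have "\<dots> \<le> 0" using M i True by (simp add: nth)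
        finally show ?thesis by simp
      qed
      then show ?thesis by (simp add: w_def)
    qed
    then show ?thesis using True by (simp add: nth)
  next
    case False
    then have Mpos: "0 < M" using M0 by simp
    have mem: "w f \<in> S" for f
      unfolding w_def using x S by (intro subspace_sum subspace_scale) auto
    have comb: "(\<Sum>j<L. \<epsilon> j *\<^sub>R w (fs ! j)) = w (F \<epsilon>)" for \<epsilon>
      unfolding w_def F_def scaleR_sum_right scaleR_sum_left scaleR_scaleR by (rule sum.swap)
    have split: "(norm (w f))\<^sup>2 \<le> 2 * (\<tau> * M * W\<^sup>2) + 2 * \<kappa> / (\<tau> * M) * (\<Sum>i<m. l i * (f i) ^ 4)" for f
    proof -
      define g where "g i = (if (f i)\<^sup>2 \<le> \<tau> * M then f i else 0)" for i
      define h where "h i = (if (f i)\<^sup>2 \<le> \<tau> * M then 0 else f i)" for i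
      have "w f = w g + w h"
        unfolding w_def sum.distrib[symmetric] by (rule sum.cong) (auto simp: g_def h_def)
      then have "norm (w f) \<le> norm (w g) + norm (w h)" by (simp add: norm_triangle_ineq)
      then have "(norm (w f))\<^sup>2 \<le> (norm (w g) + norm (w h))\<^sup>2" by (intro power_mono) auto
      also have "\<dots> \<le> 2 * (norm (w g))\<^sup>2 + 2 * (norm (w h))\<^sup>2"
        using zero_le_power2[of "norm (w g) - norm (w h)"] by (simp add: power2_eq_square algebra_simps)
      finally have 1: "(norm (w f))\<^sup>2 \<le> 2 * (norm (w g))\<^sup>2 + 2 * (norm (w h))\<^sup>2" .
      have "norm (w g) \<le> sqrt (\<tau> * M) * W"
        unfolding w_def using \<tau> Mpos by (intro W) (auto simp: g_def intro: real_le_rsqrt)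
      then have "(norm (w g))\<^sup>2 \<le> (sqrt (\<tau> * M) * W)\<^sup>2" by (intro power_mono) auto
      then have 2: "(norm (w g))\<^sup>2 \<le> \<tau> * M * W\<^sup>2"
        using \<tau> Mpos by (simp add: power_mult_distrib)
      have "(h i)\<^sup>2 \<le> (f i) ^ 4 / (\<tau> * M)" for i
      proof (cases "(f i)\<^sup>2 \<le> \<tau> * M")
        case False
        then have "(f i)\<^sup>2 * (\<tau> * M) \<le> (f i)\<^sup>2 * (f i)\<^sup>2" by (intro mult_left_mono) auto
        then show ?thesis using False \<tau> Mpos by (simp add: h_def field_simps flip: power_add)
      qed (use \<tau> Mpos in \<open>simp add: h_def\<close>)
      then have "(\<Sum>i<m. l i * (h i)\<^sup>2) \<le> (\<Sum>i<m. l i * ((f i) ^ 4 / (\<tau> * M)))"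
        using l(1) by (intro sum_mono mult_left_mono) auto
      then have "\<kappa> * (\<Sum>i<m. l i * (h i)\<^sup>2) \<le> \<kappa> * (\<Sum>i<m. l i * ((f i) ^ 4 / (\<tau> * M)))"
        using \<kappa>0 by (rule mult_left_mono)
      then have "(norm (w h))\<^sup>2 \<le> \<kappa> / (\<tau> * M) * (\<Sum>i<m. l i * (f i) ^ 4)"
        using dom[of h] by (simp flip: sum_divide_distrib)
      then show ?thesis using 1 2 by simp
    qed
    have fourth: "(\<Sum>\<epsilon>\<in>signs L. (F \<epsilon> i) ^ 4) \<le> ?K * 2 ^ L * M\<^sup>2" if "i < m" for i
      using khinchine[where k = 2 and m = L and a = "\<lambda>j. (fs ! j) i" and M = M] M that by (simp add: F_def nth)
    have "(\<Sum>\<epsilon>\<in>signs L. \<Sum>i<m. l i * (F \<epsilon> i) ^ 4) = (\<Sum>i<m. l i * (\<Sum>\<epsilon>\<in>signs L. (F \<epsilon> i) ^ 4))"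
      by (subst sum.swap) (simp add: sum_distrib_left)
    also have "\<dots> \<le> (\<Sum>i<m. l i * (?K * 2 ^ L * M\<^sup>2))"
      using l(1) fourth by (intro sum_mono mult_left_mono) auto
    also have "\<dots> = ?K * 2 ^ L * M\<^sup>2" by (simp add: l(2) flip: sum_distrib_right)
    finally have four: "(\<Sum>\<epsilon>\<in>signs L. \<Sum>i<m. l i * (F \<epsilon> i) ^ 4) \<le> ?K * 2 ^ L * M\<^sup>2" .
    have "(\<Sum>f\<leftarrow>fs. (norm (w f))\<^sup>2) \<le> C / 2 ^ L * (\<Sum>\<epsilon>\<in>signs L. (norm (w (F \<epsilon>)))\<^sup>2)"
      using cotype[of L "\<lambda>j. w (fs ! j)"] mem by (simp add: nth comb)
    also have "\<dots> \<le> C / 2 ^ L * (\<Sum>\<epsilon>\<in>signs L. 2 * (\<tau> * M * W\<^sup>2) + 2 * \<kappa> / (\<tau> * M) * (\<Sum>i<m. l i * (F \<epsilon> i) ^ 4))"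
      using C by (intro mult_left_mono sum_mono split) auto
    also have "\<dots> = C / 2 ^ L * (2 ^ L * (2 * (\<tau> * M * W\<^sup>2))
        + 2 * \<kappa> / (\<tau> * M) * (\<Sum>\<epsilon>\<in>signs L. \<Sum>i<m. l i * (F \<epsilon> i) ^ 4))"
      by (simp add: sum.distrib sum_distrib_left)
    also have "\<dots> \<le> C / 2 ^ L * (2 ^ L * (2 * (\<tau> * M * W\<^sup>2)) + 2 * \<kappa> / (\<tau> * M) * (?K * 2 ^ L * M\<^sup>2))"
      using C \<kappa>0 \<tau> Mpos by (intro mult_left_mono add_mono four) auto
    also have "\<dots> = (8 * C\<^sup>2 * ?K * W\<^sup>2 + \<kappa> / 2) * M"
      using C K Mpos by (simp add: \<tau>_def field_simps power2_eq_square)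
    finally show ?thesis .
  qed
qed

text \<open>The infimum \<open>\<kappa>\<close> of all \<open>2\<close>-summing constants is one itself, so the self-improvement gives
\<open>\<kappa> \<le> A + \<kappa> / 2\<close>.\<close>

lemma two_summing: "two_summing_le m w (16 * C\<^sup>2 * khinchine_const 2 * W\<^sup>2)"
proof -
  define A where "A = 8 * C\<^sup>2 * khinchine_const 2 * W\<^sup>2"
  have A0: "0 \<le> A" by (simp add: A_def khinchine_const_def)
  define Q where "Q = {\<kappa>. 0 \<le> \<kappa> \<and> two_summing_le m w \<kappa>}"
  have Q: "W\<^sup>2 * m \<in> Q" using two_summing_le_trivial by (simp add: Q_def)
  have bdd: "bdd_below Q" by (rule bdd_belowI[of _ 0]) (simp add: Q_def)
  define \<kappa> where "\<kappa> = Inf Q"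
  have \<kappa>0: "0 \<le> \<kappa>" unfolding \<kappa>_def using Q by (intro cInf_greatest) (blast, simp add: Q_def)
  have nonneg: "0 \<le> M" if "\<forall>i<m. (\<Sum>f\<leftarrow>fs. (f i)\<^sup>2) \<le> M" for fs :: "(nat \<Rightarrow> real) list" and M
  proof -
    have "0 \<le> (\<Sum>f\<leftarrow>fs. (f 0)\<^sup>2)" by (rule sum_list_nonneg) auto
    then show ?thesis using that m by (meson order_trans)
  qed
  have "two_summing_le m w \<kappa>"
    unfolding two_summing_le_def
  proof (intro allI impI)
    fix fs :: "(nat \<Rightarrow> real) list" and M assume M: "\<forall>i<m. (\<Sum>f\<leftarrow>fs. (f i)\<^sup>2) \<le> M"
    have le: "(\<Sum>f\<leftarrow>fs. (norm (w f))\<^sup>2) \<le> c * M" if "c \<in> Q" for c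
      using that M unfolding Q_def two_summing_le_def by blast
    show "(\<Sum>f\<leftarrow>fs. (norm (w f))\<^sup>2) \<le> \<kappa> * M"
    proof (cases "M = 0")
      case True
      then show ?thesis using le[OF Q] by simp
    next
      case False
      then have "0 < M" using nonneg[OF M] by simp
      then have "(\<Sum>f\<leftarrow>fs. (norm (w f))\<^sup>2) / M \<le> \<kappa>"
        unfolding \<kappa>_def using Q le by (intro cInf_greatest) (auto simp: pos_divide_le_eq)
      then show ?thesis using \<open>0 < M\<close> by (simp add: pos_divide_le_eq)
    qed
  qed
  then have "A + \<kappa> / 2 \<in> Q"
    using two_summing_le_improve[of \<kappa>] \<kappa>0 A0 by (simp add: Q_def A_def)
  then have "\<kappa> \<le> A + \<kappa> / 2" unfolding \<kappa>_def using bdd by (intro cInf_lower)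
  then have "\<kappa> \<le> 2 * A" by simp
  then have "two_summing_le m w (2 * A)"
    using \<open>two_summing_le m w \<kappa>\<close> nonneg unfolding two_summing_le_def
    by (meson mult_right_mono order_trans)
  then show ?thesis by (simp add: A_def mult.assoc)
qed

end

section \<open>Summing properties on cotype 2 spaces\<close>

text \<open>Hoelder's inequality, with the powers placed so that it applies without changing variables.\<close>

lemma sum_powr_mult_le:
  fixes \<alpha> \<beta> :: "'i \<Rightarrow> real"
  assumes I: "finite I" and nn: "\<And>i. i \<in> I \<Longrightarrow> 0 \<le> \<alpha> i" "\<And>i. i \<in> I \<Longrightarrow> 0 \<le> \<beta> i"
    and uv: "0 < u" "0 < v" "u + v = 1"
  shows "(\<Sum>i\<in>I. \<alpha> i powr u * \<beta> i powr v) \<le> (\<Sum>i\<in>I. \<alpha> i) powr u * (\<Sum>i\<in>I. \<beta> i) powr v"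
proof -
  define A where "A = (\<Sum>i\<in>I. \<alpha> i)"
  define B where "B = (\<Sum>i\<in>I. \<beta> i)"
  have AB: "0 \<le> A" "0 \<le> B" using nn by (auto simp: A_def B_def intro: sum_nonneg)
  show ?thesis
  proof (cases "A = 0 \<or> B = 0")
    case True
    then have "\<alpha> i powr u * \<beta> i powr v = 0" if "i \<in> I" for i
      using that I nn by (auto simp: A_def B_def sum_nonneg_eq_0_iff)
    then have "(\<Sum>i\<in>I. \<alpha> i powr u * \<beta> i powr v) = 0" by (intro sum.neutral ballI)
    then show ?thesis by simp
  next
    case False
    then have pos: "0 < A" "0 < B" using AB by auto
    have "(\<Sum>i\<in>I. (\<alpha> i / A) powr u * (\<beta> i / B) powr v) \<le> (\<Sum>i\<in>I. u * (\<alpha> i / A) + v * (\<beta> i / B))"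
    proof (rule sum_mono)
      fix i assume i: "i \<in> I"
      show "(\<alpha> i / A) powr u * (\<beta> i / B) powr v \<le> u * (\<alpha> i / A) + v * (\<beta> i / B)"
      proof (cases "\<alpha> i = 0 \<or> \<beta> i = 0")
        case True
        then show ?thesis using nn[OF i] pos uv by auto
      next
        case False
        then show ?thesis using nn[OF i] pos uv by (intro Youngs_inequality_0) (auto simp: less_le)
      qed
    qed
    also have "\<dots> = u * (A / A) + v * (B / B)"
      unfolding sum.distrib by (simp add: A_def B_def flip: sum_divide_distrib sum_distrib_left)
    also have "\<dots> = 1" using pos uv by simp
    also have "(\<Sum>i\<in>I. (\<alpha> i / A) powr u * (\<beta> i / B) powr v)
        = (\<Sum>i\<in>I. \<alpha> i powr u * \<beta> i powr v) / (A powr u * B powr v)"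
      unfolding sum_divide_distrib using nn pos by (intro sum.cong) (auto simp: powr_divide)
    finally show ?thesis using pos by (simp add: pos_divide_le_eq A_def B_def)
  qed
qed

lemma le_powr_of_self_bound:
  fixes S B :: real
  assumes "0 \<le> S" "0 \<le> B" "0 < v" "u + v = 1" and le: "S \<le> B * S powr u"
  shows "S \<le> B powr (1 / v)"
proof (cases "S = 0")
  case False
  then have "0 < S" using assms by simp
  have "S powr v * S powr u = S" using \<open>0 < S\<close> assms by (simp add: add.commute flip: powr_add)
  then have "S powr v \<le> B" using le \<open>0 < S\<close> by (metis mult_le_cancel_right_pos powr_gt_zero less_irrefl)
  then have "(S powr v) powr (1 / v) \<le> B powr (1 / v)" using assms by (intro powr_mono2) auto
  then show ?thesis using \<open>0 < S\<close> assms by (simp add: powr_powr)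
qed (use assms in simp)

lemma weak_sum_le_nonneg: "weak_sum_le s S p I x W \<Longrightarrow> 0 \<le> W"
proof -
  assume W: "weak_sum_le s S p I x W"
  have "(\<lambda>_. 0) \<in> dual_ball s S" by (simp add: dual_ball_def)
  from W[unfolded weak_sum_le_def, rule_format, OF this] show ?thesis by simp
qed

text \<open>The operator defined by \<open>x\<close> on \<open>\<ell>\<^sub>\<infinity>\<close> has a Pietsch weight \<open>l\<close>, and its domination inequality says that
\<open>y i = x i / \<surd>(l i)\<close> is weakly \<open>2\<close>-summable. By homogeneity
\<open>\<Sum>i. N (x i) = \<Sum>i. \<surd>(l i) N (y i)\<close>, which is estimated by the Cauchy-Schwarz inequality.\<close>

lemma one_summing_of_two_summing:
  fixes s :: "'k::real_or_complex \<Rightarrow> 'a::real_normed_vector \<Rightarrow> 'a" and N :: "'a \<Rightarrow> real" and m :: nat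
  assumes s: "normed_space_over s" and S: "subspace S" and C: "0 < C"
    and cotype: "\<And>l y. (\<And>i. i < l \<Longrightarrow> y i \<in> S) \<Longrightarrow>
      (\<Sum>i<l. (norm (y i))\<^sup>2) \<le> C / 2 ^ l * (\<Sum>\<epsilon>\<in>signs l. (norm (\<Sum>i<l. \<epsilon> i *\<^sub>R y i))\<^sup>2)"
    and hom: "\<And>t x. x \<in> S \<Longrightarrow> N (t *\<^sub>R x) = \<bar>t\<bar> * N x"
    and two: "\<And>y W. (\<And>i. i < m \<Longrightarrow> y i \<in> S) \<Longrightarrow> weak_sum_le s S 2 {..<m} y W \<Longrightarrow> (\<Sum>i<m. (N (y i))\<^sup>2) \<le> A * W"
    and A: "0 \<le> A"
    and x: "\<And>i. i < m \<Longrightarrow> x i \<in> S" and weak: "weak_sum_le s S 1 {..<m} x W"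
  shows "(\<Sum>i<m. N (x i)) \<le> sqrt (32 * C\<^sup>2 * khinchine_const 2 * A) * W"
proof (cases "m = 0")
  case True
  then show ?thesis using weak_sum_le_nonneg[OF weak] A by (simp add: khinchine_const_def)
next
  case False
  interpret linf_into_cotype_2 m x S C W
  proof
    show "norm (\<Sum>i<m. a i *\<^sub>R x i) \<le> t * W" if "\<And>i. i < m \<Longrightarrow> \<bar>a i\<bar> \<le> t" "0 \<le> t" for a t
      using that by (intro norm_sum_le_weak_sum[OF s S _ _ weak]) (auto intro: x)
  qed (use False S x C cotype in auto)
  define \<kappa> where "\<kappa> = 16 * C\<^sup>2 * khinchine_const 2 * W\<^sup>2"
  have \<kappa>0: "0 \<le> \<kappa>" by (simp add: \<kappa>_def khinchine_const_def)
  obtain l where l: "\<And>i. i < m \<Longrightarrow> 0 \<le> l i" "(\<Sum>i<m. l i) = 1"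
    and dom: "\<And>f. (norm (w f))\<^sup>2 \<le> \<kappa> * (\<Sum>i<m. l i * (f i)\<^sup>2)"
    using pietsch_domination_linf[OF m norm_w_scale two_summing] unfolding \<kappa>_def by blast
  (* Where the weight l i vanishes, the domination inequality forces x i = 0. *)
  define y where "y i = (if 0 < l i then (1 / sqrt (l i)) *\<^sub>R x i else 0)" for i
  have yS: "y i \<in> S" if "i < m" for i
    using x[OF that] S by (simp add: y_def subspace_scale subspace_0)
  have "weak_sum_le s S 2 {..<m} y (2 * \<kappa>)"
  proof (rule weak_sum_le_of_l2_bound[OF s S _ _ \<kappa>0])
    fix b :: "nat \<Rightarrow> real"
    define a where "a i = (if 0 < l i then b i / sqrt (l i) else 0)" for i
    have "(\<Sum>i<m. b i *\<^sub>R y i) = w a"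
      unfolding w_def by (rule sum.cong) (auto simp: y_def a_def)
    then have "(norm (\<Sum>i<m. b i *\<^sub>R y i))\<^sup>2 \<le> \<kappa> * (\<Sum>i<m. l i * (a i)\<^sup>2)" using dom[of a] by simp
    also have "\<dots> \<le> \<kappa> * (\<Sum>i<m. (b i)\<^sup>2)"
      using \<kappa>0 by (intro mult_left_mono sum_mono) (auto simp: a_def power_divide)
    finally show "(norm (\<Sum>i<m. b i *\<^sub>R y i))\<^sup>2 \<le> \<kappa> * (\<Sum>i<m. (b i)\<^sup>2)" .
  qed (auto simp: yS)
  then have Ny: "(\<Sum>i<m. (N (y i))\<^sup>2) \<le> A * (2 * \<kappa>)" by (intro two yS)
  have "N (x i) = sqrt (l i) * N (y i)" if i: "i < m" for i
  proof (cases "0 < l i")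
    case True
    then show ?thesis using x[OF i] by (simp add: y_def hom)
  next
    case False
    then have "l i = 0" using l(1)[OF i] by simp
    define e where "e k = (if k = i then 1 else 0 :: real)" for k
    have "w e = (\<Sum>k<m. if k = i then x k else 0)"
      unfolding w_def by (rule sum.cong) (auto simp: e_def)
    then have "w e = x i" using i by simp
    moreover have "(\<Sum>k<m. l k * (e k)\<^sup>2) = 0"
      by (rule sum.neutral) (simp add: e_def \<open>l i = 0\<close>)
    ultimately have "x i = 0" using dom[of e] by simp
    then show ?thesis using hom[of 0 0] subspace_0[OF S] \<open>l i = 0\<close> by simp
  qed
  then have "(\<Sum>i<m. N (x i)) = (\<Sum>i<m. sqrt (l i) * N (y i))" by simp
  then have "(\<Sum>i<m. N (x i))\<^sup>2 \<le> (\<Sum>i<m. (sqrt (l i))\<^sup>2) * (\<Sum>i<m. (N (y i))\<^sup>2)"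
    using Cauchy_Schwarz_ineq_sum[of "\<lambda>i. sqrt (l i)" "\<lambda>i. N (y i)" "{..<m}"] by simp
  also have "(\<Sum>i<m. (sqrt (l i))\<^sup>2) = 1" using l by simp
  also have "1 * (\<Sum>i<m. (N (y i))\<^sup>2) \<le> 32 * C\<^sup>2 * khinchine_const 2 * A * W\<^sup>2"
    using Ny by (simp add: \<kappa>_def algebra_simps)
  finally have "(\<Sum>i<m. N (x i)) \<le> sqrt (32 * C\<^sup>2 * khinchine_const 2 * A * W\<^sup>2)"
    by (rule real_le_rsqrt)
  then show ?thesis using weak_sum_le_nonneg[OF weak] by (simp add: real_sqrt_mult)
qed

text \<open>Apply the case \<open>r = 1\<close> to the family \<open>N (x i)\<^bsup>r-1\<^esup> x i\<close>, which is weakly \<open>1\<close>-summable by Hoelder's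
inequality. The left hand side becomes \<open>\<Sum>i. N (x i)\<^bsup>r\<^esup>\<close>, and a smaller power of the same sum appears on the
right. The bound \<open>B\<close> depends neither on the length \<open>m\<close> of the family nor on \<open>N\<close>.\<close>

lemma r_summing_of_two_summing:
  fixes s :: "'k::real_or_complex \<Rightarrow> 'a::real_normed_vector \<Rightarrow> 'a"
  assumes s: "normed_space_over s" and S: "subspace S" and cot: "cotype 2 S"
    and r: "1 \<le> r" and A: "0 \<le> A"
  shows "\<exists>B. \<forall>(m::nat) N x. (\<forall>x. 0 \<le> N x) \<longrightarrow> (\<forall>t. \<forall>x\<in>S. N (t *\<^sub>R x) = \<bar>t\<bar> * N x) \<longrightarrow>
      (\<forall>y W. (\<forall>i<m. y i \<in> S) \<longrightarrow> weak_sum_le s S 2 {..<m} y W \<longrightarrow> (\<Sum>i<m. (N (y i))\<^sup>2) \<le> A * W) \<longrightarrow>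
      (\<forall>i<m. x i \<in> S) \<longrightarrow> weak_sum_le s S r {..<m} x 1 \<longrightarrow> (\<Sum>i<m. N (x i) powr r) \<le> B"
proof -
  obtain C where C: "0 < C" and cotype: "\<And>l y. (\<And>i. i < l \<Longrightarrow> y i \<in> S) \<Longrightarrow>
      (\<Sum>i<l. (norm (y i))\<^sup>2) \<le> C / 2 ^ l * (\<Sum>\<epsilon>\<in>signs l. (norm (\<Sum>i<l. \<epsilon> i *\<^sub>R y i))\<^sup>2)"
    using cot by (rule cotype_2E) blast
  define D where "D = sqrt (32 * C\<^sup>2 * khinchine_const 2 * A)"
  have D0: "0 \<le> D" using A by (simp add: D_def khinchine_const_def)
  have "(\<Sum>i<m. N (x i) powr r) \<le> D powr r"
    if N0: "\<And>x. 0 \<le> N x" and hom: "\<And>t x. x \<in> S \<Longrightarrow> N (t *\<^sub>R x) = \<bar>t\<bar> * N x"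
      and two: "\<And>y W. (\<And>i. i < m \<Longrightarrow> y i \<in> S) \<Longrightarrow> weak_sum_le s S 2 {..<m} y W \<Longrightarrow> (\<Sum>i<m. (N (y i))\<^sup>2) \<le> A * W"
      and x: "\<And>i. i < m \<Longrightarrow> x i \<in> S" and W: "weak_sum_le s S r {..<m} x 1" for m :: nat and N x
  proof -
    have one: "(\<Sum>i<m. N (z i)) \<le> D * V" if "\<And>i. i < m \<Longrightarrow> z i \<in> S" "weak_sum_le s S 1 {..<m} z V" for z V
      unfolding D_def by (rule one_summing_of_two_summing[where s = s and S = S and C = C and N = N and m = m and A = A])
        (fact s S C cotype hom two A that)+
    show ?thesis
    proof (cases "r = 1")
      case True
      then show ?thesis using one[of x 1] x W N0 D0 by simp
    next
      case False
      then have r1: "1 < r" using r by simp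
      define u v where "u = (r - 1) / r" and "v = 1 / r"
      have uv: "0 < u" "0 < v" "u + v = 1" using r1 by (auto simp: u_def v_def field_simps)
      define T where "T = (\<Sum>i<m. N (x i) powr r)"
      have T0: "0 \<le> T" by (simp add: T_def sum_nonneg)
      define c where "c i = N (x i) powr (r - 1)" for i
      have "weak_sum_le s S 1 {..<m} (\<lambda>i. c i *\<^sub>R x i) (T powr u)"
        unfolding weak_sum_le_def
      proof
        fix \<phi> assume \<phi>: "\<phi> \<in> dual_ball s S"
        have "norm (\<phi> (c i *\<^sub>R x i)) = c i * norm (\<phi> (x i))" if "i < m" for i
          using dual_ball_sum[OF s S \<phi>, of "{i}" x c] x[OF that] by (simp add: c_def)
        then have "(\<Sum>i<m. norm (\<phi> (c i *\<^sub>R x i)) powr 1)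
            = (\<Sum>i<m. (N (x i) powr r) powr u * (norm (\<phi> (x i)) powr r) powr v)"
          using r1 by (intro sum.cong) (auto simp: c_def powr_powr u_def v_def)
        also have "\<dots> \<le> T powr u * (\<Sum>i<m. norm (\<phi> (x i)) powr r) powr v"
          unfolding T_def by (rule sum_powr_mult_le[OF finite_lessThan]) (auto simp: uv)
        also have "\<dots> \<le> T powr u * 1 powr v"
          using W \<phi> uv by (intro mult_left_mono powr_mono2) (auto simp: weak_sum_le_def sum_nonneg)
        finally show "(\<Sum>i<m. norm (\<phi> (c i *\<^sub>R x i)) powr 1) \<le> T powr u" by simp
      qed
      then have "(\<Sum>i<m. N (c i *\<^sub>R x i)) \<le> D * T powr u"
        using x S by (intro one) (auto intro: subspace_scale)
      also have "(\<Sum>i<m. N (c i *\<^sub>R x i)) = T"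
        unfolding T_def
      proof (rule sum.cong)
        fix i assume "i \<in> {..<m}"
        then have "N (c i *\<^sub>R x i) = N (x i) powr (r - 1) * N (x i) powr 1"
          using x N0[of "x i"] by (simp add: hom c_def)
        then show "N (c i *\<^sub>R x i) = N (x i) powr r" using powr_add[of "N (x i)" "r - 1" 1] by simp
      qed simp
      finally have "T \<le> D powr (1 / v)" by (rule le_powr_of_self_bound[OF T0 D0 uv(2,3)])
      then show ?thesis by (simp add: v_def T_def)
    qed
  qed
  then show ?thesis by (intro exI[of _ "D powr r"]) blast
qed

section \<open>Sign averages and multi-indices\<close>

lemma khinchine_scalar:
  fixes z :: "nat \<Rightarrow> 'k::real_or_complex"
  assumes k: "1 \<le> k" and z: "(\<Sum>i<m. (norm (z i))\<^sup>2) \<le> 1"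
  shows "(\<Sum>\<epsilon>\<in>signs m. norm (\<Sum>i<m. \<epsilon> i *\<^sub>R z i) ^ (2 * k)) \<le> 2 ^ k * (2 * khinchine_const k) * 2 ^ m"
proof -
  obtain re im :: "'k \<Rightarrow> real" where lin: "linear re" "linear im"
    and norm: "\<And>z. (norm z)\<^sup>2 = (re z)\<^sup>2 + (im z)\<^sup>2" using scalar_parts by blast
  have part: "(\<Sum>\<epsilon>\<in>signs m. (\<Sum>i<m. \<epsilon> i * h (z i)) ^ (2 * k)) \<le> khinchine_const k * 2 ^ m"
    if "\<And>z. (h z)\<^sup>2 \<le> (norm z)\<^sup>2" for h
  proof -
    have "(\<Sum>i<m. (h (z i))\<^sup>2) \<le> 1" using z that by (meson order_trans sum_mono)
    from khinchine[OF k this] show ?thesis by simp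
  qed
  have pow: "(a + b) ^ k \<le> 2 ^ k * (a ^ k + b ^ k)" if "0 \<le> a" "0 \<le> b" for a b :: real
  proof -
    have "(a + b) ^ k \<le> (2 * max a b) ^ k" using that by (intro power_mono) auto
    also have "\<dots> \<le> 2 ^ k * (a ^ k + b ^ k)" using that by (auto simp: power_mult_distrib max_def)
    finally show ?thesis .
  qed
  have "norm (\<Sum>i<m. \<epsilon> i *\<^sub>R z i) ^ (2 * k)
      \<le> 2 ^ k * ((\<Sum>i<m. \<epsilon> i * re (z i)) ^ (2 * k) + (\<Sum>i<m. \<epsilon> i * im (z i)) ^ (2 * k))" for \<epsilon> :: "nat \<Rightarrow> real"
  proof -
    have "norm (\<Sum>i<m. \<epsilon> i *\<^sub>R z i) ^ (2 * k)
        = ((\<Sum>i<m. \<epsilon> i * re (z i))\<^sup>2 + (\<Sum>i<m. \<epsilon> i * im (z i))\<^sup>2) ^ k"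
      by (simp add: power_mult norm linear_sum[OF lin(1)] linear_sum[OF lin(2)] linear_scale[OF lin(1)] linear_scale[OF lin(2)])
    also have "\<dots> \<le> 2 ^ k * (((\<Sum>i<m. \<epsilon> i * re (z i))\<^sup>2) ^ k + ((\<Sum>i<m. \<epsilon> i * im (z i))\<^sup>2) ^ k)"
      by (intro pow) auto
    finally show ?thesis by (simp only: power_mult)
  qed
  then have "(\<Sum>\<epsilon>\<in>signs m. norm (\<Sum>i<m. \<epsilon> i *\<^sub>R z i) ^ (2 * k))
      \<le> (\<Sum>\<epsilon>\<in>signs m. 2 ^ k * ((\<Sum>i<m. \<epsilon> i * re (z i)) ^ (2 * k) + (\<Sum>i<m. \<epsilon> i * im (z i)) ^ (2 * k)))"
    by (intro sum_mono)
  also have "\<dots> = 2 ^ k * ((\<Sum>\<epsilon>\<in>signs m. (\<Sum>i<m. \<epsilon> i * re (z i)) ^ (2 * k))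
                       + (\<Sum>\<epsilon>\<in>signs m. (\<Sum>i<m. \<epsilon> i * im (z i)) ^ (2 * k)))"
    by (simp only: sum.distrib flip: sum_distrib_left)
  also have "\<dots> \<le> 2 ^ k * (khinchine_const k * 2 ^ m + khinchine_const k * 2 ^ m)"
    by (intro mult_left_mono add_mono part) (auto simp: norm)
  finally show ?thesis by (simp add: algebra_simps)
qed

lemma sum_PiE_insert:
  assumes "k \<notin> F"
  shows "(\<Sum>f\<in>PiE (insert k F) A. h f) = (\<Sum>f\<in>PiE F A. \<Sum>y\<in>A k. h (f(k := y)))"
proof -
  have "(\<Sum>f\<in>PiE (insert k F) A. h f) = (\<Sum>(y, f)\<in>A k \<times> PiE F A. h (f(k := y)))"
    unfolding PiE_insert_eq by (subst sum.reindex[OF inj_combinator[OF assms]]) (simp add: case_prod_unfold)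
  also have "\<dots> = (\<Sum>y\<in>A k. \<Sum>f\<in>PiE F A. h (f(k := y)))" by (simp add: sum.cartesian_product)
  finally show ?thesis by (subst (asm) sum.swap)
qed

text \<open>An inequality that holds in every single coordinate, whatever the entries of the others, tensorises:
replace the sums over \<open>I\<close> by the sums over \<open>E\<close> in one coordinate after the other.\<close>

lemma sum_PiE_coordinatewise_le:
  fixes G :: "('i \<Rightarrow> 'a) \<Rightarrow> real"
  assumes F: "finite F" and c: "0 \<le> c" and v: "v \<in> PiE F X"
    and x: "\<And>k i. k \<in> F \<Longrightarrow> i \<in> I \<Longrightarrow> x k i \<in> X k" and z: "\<And>k e. k \<in> F \<Longrightarrow> e \<in> E \<Longrightarrow> z k e \<in> X k"
    and step: "\<And>k v. k \<in> F \<Longrightarrow> v \<in> PiE F X \<Longrightarrow> (\<Sum>i\<in>I. G (v(k := x k i))) \<le> c * (\<Sum>e\<in>E. G (v(k := z k e)))"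
  shows "(\<Sum>i\<in>PiE F (\<lambda>_. I). G (\<lambda>k\<in>F. x k (i k))) \<le> c ^ card F * (\<Sum>e\<in>PiE F (\<lambda>_. E). G (\<lambda>k\<in>F. z k (e k)))"
proof -
  have gen: "(\<Sum>i\<in>PiE H (\<lambda>_. I). G (\<lambda>k. if k \<in> H then x k (i k) else v k))
      \<le> c ^ card H * (\<Sum>e\<in>PiE H (\<lambda>_. E). G (\<lambda>k. if k \<in> H then z k (e k) else v k))"
    if "finite H" "H \<subseteq> F" "v \<in> PiE F X" for H v
    using that
  proof (induction H arbitrary: v rule: finite_induct)
    case (insert k H)
    have k: "k \<in> F" "k \<notin> H" and H: "H \<subseteq> F" using insert by auto
    have upd: "(\<lambda>l. if l \<in> insert k H then x l ((i(k := y)) l) else v l)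
        = (\<lambda>l. if l \<in> H then x l (i l) else v l)(k := x k y)" for i y
      using k(2) by (auto simp: fun_eq_iff)
    have upd': "(\<lambda>l. if l \<in> insert k H then z l ((i(k := y)) l) else v l)
        = (\<lambda>l. if l \<in> H then z l (i l) else (v(k := z k y)) l)" for i y
      using k(2) by (auto simp: fun_eq_iff)
    have swap: "(\<lambda>l. if l \<in> H then x l (i l) else v l)(k := a)
        = (\<lambda>l. if l \<in> H then x l (i l) else (v(k := a)) l)" for i a
      using k(2) by (auto simp: fun_eq_iff)
    have "(\<Sum>i\<in>PiE (insert k H) (\<lambda>_. I). G (\<lambda>l. if l \<in> insert k H then x l (i l) else v l))
        = (\<Sum>i\<in>PiE H (\<lambda>_. I). \<Sum>y\<in>I. G ((\<lambda>l. if l \<in> H then x l (i l) else v l)(k := x k y)))"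
      by (simp only: sum_PiE_insert[OF k(2)] upd)
    also have "\<dots> \<le> (\<Sum>i\<in>PiE H (\<lambda>_. I). c * (\<Sum>e\<in>E. G ((\<lambda>l. if l \<in> H then x l (i l) else v l)(k := z k e))))"
    proof (intro sum_mono step k(1))
      fix i assume "i \<in> PiE H (\<lambda>_. I)"
      then show "(\<lambda>l. if l \<in> H then x l (i l) else v l) \<in> PiE F X"
        using H x insert.prems(2) by (auto simp: PiE_iff extensional_def)
    qed
    also have "\<dots> = c * (\<Sum>e\<in>E. \<Sum>i\<in>PiE H (\<lambda>_. I). G (\<lambda>l. if l \<in> H then x l (i l) else (v(k := z k e)) l))"
      unfolding swap sum_distrib_left[symmetric] by (subst sum.swap) (rule refl)
    also have "\<dots> \<le> c * (\<Sum>e\<in>E. c ^ card H *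
        (\<Sum>i\<in>PiE H (\<lambda>_. E). G (\<lambda>l. if l \<in> H then z l (i l) else (v(k := z k e)) l)))"
    proof (intro mult_left_mono[OF _ c] sum_mono insert.IH H)
      fix e assume "e \<in> E"
      then show "v(k := z k e) \<in> PiE F X"
        using k(1) z insert.prems(2) by (auto simp: PiE_iff extensional_def)
    qed
    also have "\<dots> = c ^ card (insert k H) *
        (\<Sum>i\<in>PiE H (\<lambda>_. E). \<Sum>e\<in>E. G (\<lambda>l. if l \<in> H then z l (i l) else (v(k := z k e)) l))"
      using insert.hyps by (subst sum.swap) (simp add: mult.assoc flip: sum_distrib_left)
    also have "\<dots> = c ^ card (insert k H) *
        (\<Sum>i\<in>PiE (insert k H) (\<lambda>_. E). G (\<lambda>l. if l \<in> insert k H then z l (i l) else v l))"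
      by (simp only: sum_PiE_insert[OF k(2)] upd')
    finally show ?case .
  qed simp
  have restr: "(\<lambda>k. if k \<in> F then u k else v k) = (\<lambda>k\<in>F. u k)" for u
    using v by (auto simp: fun_eq_iff PiE_iff extensional_def)
  show ?thesis using gen[OF F subset_refl v] by (simp only: restr)
qed

lemma sum_PiE_one_coordinate:
  assumes F: "finite F" "k \<in> F" and E: "finite E"
  shows "(\<Sum>e\<in>PiE F (\<lambda>_. E). h (e k)) = real (card E) ^ (card F - 1) * (\<Sum>e\<in>E. h e :: real)"
proof -
  have "F = insert k (F - {k})" using F by blast
  then have "(\<Sum>e\<in>PiE F (\<lambda>_. E). h (e k)) = (\<Sum>e\<in>PiE (insert k (F - {k})) (\<lambda>_. E). h (e k))" by simp
  also have "\<dots> = real (card (PiE (F - {k}) (\<lambda>_. E))) * (\<Sum>e\<in>E. h e)"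
    by (subst sum_PiE_insert) auto
  also have "card (PiE (F - {k}) (\<lambda>_. E)) = card E ^ (card F - 1)"
    using F by (simp add: card_PiE)
  finally show ?thesis by simp
qed

section \<open>Real multilinear maps on subspaces\<close>

locale real_multilinear =
  fixes n :: nat and X :: "nat \<Rightarrow> 'a::real_normed_vector set" and T :: "(nat \<Rightarrow> 'a) \<Rightarrow> 'y::real_normed_vector"
  assumes X: "\<And>k. k \<in> {1..n} \<Longrightarrow> subspace (X k)"
    and T_add: "\<And>x k a b. x \<in> PiE {1..n} X \<Longrightarrow> k \<in> {1..n} \<Longrightarrow> a \<in> X k \<Longrightarrow> b \<in> X k \<Longrightarrow>
      T (x(k := a + b)) = T (x(k := a)) + T (x(k := b))"
    and T_scale: "\<And>x k t a. x \<in> PiE {1..n} X \<Longrightarrow> k \<in> {1..n} \<Longrightarrow> a \<in> X k \<Longrightarrow>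
      T (x(k := t *\<^sub>R a)) = t *\<^sub>R T (x(k := a))"
begin

lemma T_sum:
  assumes x: "x \<in> PiE {1..n} X" and k: "k \<in> {1..n}" and I: "finite I" "\<And>i. i \<in> I \<Longrightarrow> v i \<in> X k"
  shows "T (x(k := \<Sum>i\<in>I. a i *\<^sub>R v i)) = (\<Sum>i\<in>I. a i *\<^sub>R T (x(k := v i)))"
  using I
proof (induction I rule: finite_induct)
  case empty
  show ?case using T_scale[OF x k subspace_0[OF X[OF k]], of 0] by (simp only: sum.empty scaleR_zero_left)
next
  case (insert i I)
  then have "a i *\<^sub>R v i \<in> X k" "(\<Sum>i\<in>I. a i *\<^sub>R v i) \<in> X k"
    using X[OF k] by (auto intro!: subspace_scale subspace_sum)
  note T_add[OF x k this]
  moreover have "T (x(k := a i *\<^sub>R v i)) = a i *\<^sub>R T (x(k := v i))"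
    by (rule T_scale[OF x k]) (rule insert.prems, simp)
  moreover have "T (x(k := \<Sum>i\<in>I. a i *\<^sub>R v i)) = (\<Sum>i\<in>I. a i *\<^sub>R T (x(k := v i)))"
    by (rule insert.IH) (rule insert.prems, simp)
  ultimately show ?case by (simp only: sum.insert[OF insert.hyps])
qed

lemma T_scale_all:
  assumes x: "x \<in> PiE {1..n} X"
  shows "T (\<lambda>k\<in>{1..n}. t *\<^sub>R x k) = t ^ n *\<^sub>R T x"
proof -
  have "T (\<lambda>k. if k \<in> {1..m} then t *\<^sub>R x k else x k) = t ^ m *\<^sub>R T x" if "m \<le> n" for m
    using that
  proof (induction m)
    case (Suc m)
    let ?x = "\<lambda>k. if k \<in> {1..m} then t *\<^sub>R x k else x k"
    have S: "Suc m \<in> {1..n}" using Suc.prems by simp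
    have "?x \<in> PiE {1..n} X" using x X Suc.prems by (auto simp: PiE_iff extensional_def subspace_scale)
    moreover have "x (Suc m) \<in> X (Suc m)" using x S by blast
    ultimately have "T (?x(Suc m := t *\<^sub>R x (Suc m))) = t *\<^sub>R T (?x(Suc m := x (Suc m)))"
      by (rule T_scale[OF _ S])
    moreover have "?x(Suc m := x (Suc m)) = ?x" by (auto simp: fun_eq_iff)
    moreover have "?x(Suc m := t *\<^sub>R x (Suc m)) = (\<lambda>k. if k \<in> {1..Suc m} then t *\<^sub>R x k else x k)"
      by (auto simp: fun_eq_iff)
    ultimately show ?case using Suc by simp
  qed simp
  moreover have "(\<lambda>k. if k \<in> {1..n} then t *\<^sub>R x k else x k) = (\<lambda>k\<in>{1..n}. t *\<^sub>R x k)"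
    using x by (auto simp: fun_eq_iff PiE_iff extensional_def restrict_def)
  ultimately show ?thesis by (metis order_refl)
qed

end

section \<open>Dominated multilinear operators\<close>

lemma dual_ball_scaleR:
  assumes "normed_space_over s" "subspace S" "\<phi> \<in> dual_ball s S" "x \<in> S"
  shows "\<phi> (t *\<^sub>R x) = t *\<^sub>R \<phi> x"
  using dual_ball_sum[OF assms(1-3), of "{()}" "\<lambda>_. x" "\<lambda>_. t"] assms(4) by simp

lemma weak_sum_le_scaleR:
  assumes s: "normed_space_over s" "subspace S" and x: "\<And>i. i \<in> I \<Longrightarrow> x i \<in> S"
    and W: "weak_sum_le s S p I x W" and t: "0 \<le> t"
  shows "weak_sum_le s S p I (\<lambda>i. t *\<^sub>R x i) (t powr p * W)"
  unfolding weak_sum_le_def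
proof
  fix \<phi> assume \<phi>: "\<phi> \<in> dual_ball s S"
  have "(\<Sum>i\<in>I. norm (\<phi> (t *\<^sub>R x i)) powr p) = t powr p * (\<Sum>i\<in>I. norm (\<phi> (x i)) powr p)"
    unfolding sum_distrib_left using t x
    by (intro sum.cong) (auto simp: dual_ball_scaleR[OF s \<phi>] powr_mult)
  also have "\<dots> \<le> t powr p * W" using W \<phi> by (intro mult_left_mono) (auto simp: weak_sum_le_def)
  finally show "(\<Sum>i\<in>I. norm (\<phi> (t *\<^sub>R x i)) powr p) \<le> t powr p * W" .
qed

context real_multilinear
begin

text \<open>The domination inequality for finite families with a common weak bound \<open>W\<close> in all coordinates;
scaling all coordinates by \<open>t\<close> multiplies both sides by \<open>t powr p\<close>.\<close>

definition dominated_le :: "('k::real_or_complex \<Rightarrow> 'a \<Rightarrow> 'a) \<Rightarrow> real \<Rightarrow> real \<Rightarrow> bool" where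
  "dominated_le s p D \<longleftrightarrow> (\<forall>(M::nat) x W. 0 < W \<longrightarrow> (\<forall>k\<in>{1..n}. \<forall>i<M. x k i \<in> X k) \<longrightarrow>
     (\<forall>k\<in>{1..n}. weak_sum_le s (X k) p {..<M} (x k) W) \<longrightarrow>
     (\<Sum>i<M. norm (T (\<lambda>k\<in>{1..n}. x k i)) powr (p / n)) \<le> D * W)"

lemma norm_T_scale_all:
  assumes "1 \<le> n" "\<And>k. k \<in> {1..n} \<Longrightarrow> x k \<in> X k" "0 \<le> t"
  shows "norm (T (\<lambda>k\<in>{1..n}. t *\<^sub>R x k)) powr (p / n) = t powr p * norm (T (\<lambda>k\<in>{1..n}. x k)) powr (p / n)"
proof -
  have "(\<lambda>k\<in>{1..n}. x k) \<in> PiE {1..n} X" using assms(2) by auto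
  from T_scale_all[OF this, of t]
  have "T (\<lambda>k\<in>{1..n}. t *\<^sub>R (\<lambda>k\<in>{1..n}. x k) k) = t ^ n *\<^sub>R T (\<lambda>k\<in>{1..n}. x k)" .
  moreover have "(\<lambda>k\<in>{1..n}. t *\<^sub>R (\<lambda>k\<in>{1..n}. x k) k) = (\<lambda>k\<in>{1..n}. t *\<^sub>R x k)"
    by (rule restrict_ext) simp
  ultimately have "norm (T (\<lambda>k\<in>{1..n}. t *\<^sub>R x k)) = t ^ n * norm (T (\<lambda>k\<in>{1..n}. x k))"
    using assms(3) by simp
  moreover have "(t ^ n) powr (p / n) = t powr p"
    using assms(1,3) by (cases "t = 0") (simp_all add: powr_powr flip: powr_realpow)
  ultimately show ?thesis using assms(3) by (simp add: powr_mult)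
qed

text \<open>A gliding hump argument in place of the closed graph theorem. If no constant worked, there would be
normalised finite families with sums larger than \<open>4 ^ N\<close> for every \<open>N\<close>. Scaling the \<open>N\<close>-th family such that
its weak \<open>p\<close>-sums are at most \<open>2\<^bsup>-N\<^esup>\<close> and arranging all of them in one sequence, with zeros in between,
gives a weakly \<open>p\<close>-summable sequence on which \<open>T\<close> is not summable.\<close>

lemma dominated_le_uniform:
  fixes s :: "'k::real_or_complex \<Rightarrow> 'a \<Rightarrow> 'a"
  assumes s: "normed_space_over s" and n: "1 \<le> n" and p: "0 < p"
    and dom: "\<And>x. (\<And>k. k \<in> {1..n} \<Longrightarrow> x k \<in> weak_lp_space p s (X k)) \<Longrightarrow>
      (\<lambda>j. T (\<lambda>k\<in>{1..n}. x k j)) \<in> lp_space (p / n) UNIV"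
  shows "\<exists>D\<ge>0. dominated_le s p D"
proof -
  define ok where "ok M x \<longleftrightarrow> (\<forall>k\<in>{1..n}. (\<forall>i<M. x k i \<in> X k) \<and> weak_sum_le s (X k) p {..<M} (x k) 1)"
    for M :: nat and x
  define Tsum where "Tsum M x = (\<Sum>i<M. norm (T (\<lambda>k\<in>{1..n}. x k i)) powr (p / n))" for M :: nat and x
  have "\<exists>D\<ge>0. \<forall>M x. ok M x \<longrightarrow> Tsum M x \<le> D"
  proof (rule ccontr)
    assume neg: "\<not> ?thesis"
    have "\<exists>M x. ok M x \<and> 4 ^ N < Tsum M x" for N :: nat
    proof -
      have "(0::real) \<le> 4 ^ N" by simp
      with neg have "\<not> (\<forall>M x. ok M x \<longrightarrow> Tsum M x \<le> 4 ^ N)" by blast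
      then show ?thesis unfolding not_all not_imp not_le .
    qed
    then have "\<forall>N. \<exists>M x. ok M x \<and> 4 ^ N < Tsum M x" by blast
    then obtain M x where Mx: "\<forall>N. ok (M N) (x N) \<and> 4 ^ N < Tsum (M N) (x N)" unfolding choice_iff by blast
    then have ok: "ok (M N) (x N)" and large: "4 ^ N < Tsum (M N) (x N)" for N by blast+
    have xX: "x N k i \<in> X k" if "k \<in> {1..n}" "i < M N" for N k i using ok[of N] that by (auto simp: ok_def)
    (* The scaling factor that multiplies weak p-sums by 2 ^ (- N). *)
    define c where "c N = (1 / 2) powr (real N / p)" for N :: nat
    have c0: "0 \<le> c N" for N by (simp add: c_def)
    have cp: "c N powr p = (1 / 2) ^ N" for N using p by (simp add: c_def powr_powr powr_realpow)
    define f where "f k = (\<lambda>(N, i). if i < M N then c N *\<^sub>R x N k i else 0)" for k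
    have f_in: "f k (N, i) = c N *\<^sub>R x N k i" if "i \<in> {..<M N}" for k N i using that by (simp add: f_def)
    define y where "y k j = f k (prod_decode j)" for k j
    have fX: "f k (N, i) \<in> X k" if "k \<in> {1..n}" for k N i
      using X[OF that] xX[OF that] by (auto simp: f_def subspace_0 subspace_scale)
    have "y k \<in> weak_lp_space p s (X k)" if k: "k \<in> {1..n}" for k
    proof -
      have "(\<Sum>j. ennreal (norm (\<phi> (y k j)) powr p)) \<le> ennreal 2" if \<phi>: "\<phi> \<in> dual_ball s (X k)" for \<phi>
      proof -
        note scale = dual_ball_scaleR[OF s X[OF k] \<phi>]
        have \<phi>0: "\<phi> 0 = 0" using scale[OF subspace_0[OF X[OF k]], of 0] by simp
        have row: "(\<Sum>i. ennreal (norm (\<phi> (f k (N, i))) powr p)) \<le> ennreal ((1 / 2) ^ N)" for N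
        proof -
          have "weak_sum_le s (X k) p {..<M N} (x N k) 1" using ok[of N] k by (simp add: ok_def)
          then have "weak_sum_le s (X k) p {..<M N} (\<lambda>i. c N *\<^sub>R x N k i) (c N powr p * 1)"
            using xX[OF k] by (intro weak_sum_le_scaleR[OF s X[OF k] _ _ c0]) auto
          then have "(\<Sum>i<M N. norm (\<phi> (c N *\<^sub>R x N k i)) powr p) \<le> (1 / 2) ^ N"
            using \<phi> unfolding weak_sum_le_def cp by simp
          also have "(\<Sum>i<M N. norm (\<phi> (c N *\<^sub>R x N k i)) powr p) = (\<Sum>i<M N. norm (\<phi> (f k (N, i))) powr p)"
            by (rule sum.cong[OF refl]) (simp only: f_in)
          finally have "(\<Sum>i<M N. ennreal (norm (\<phi> (f k (N, i))) powr p)) \<le> ennreal ((1 / 2) ^ N)"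
            by (subst sum_ennreal) (auto intro: ennreal_leI)
          moreover have "(\<Sum>i. ennreal (norm (\<phi> (f k (N, i))) powr p)) = (\<Sum>i<M N. ennreal (norm (\<phi> (f k (N, i))) powr p))"
            by (rule suminf_finite) (auto simp: f_def \<phi>0)
          ultimately show ?thesis by simp
        qed
        have "(\<Sum>j. ennreal (norm (\<phi> (y k j)) powr p)) = (\<Sum>N. \<Sum>i. ennreal (norm (\<phi> (f k (N, i))) powr p))"
          unfolding y_def by (rule suminf_ennreal_2dimen[where f = "\<lambda>z. ennreal (norm (\<phi> (f k z)) powr p)"]) simp
        also have "\<dots> \<le> (\<Sum>N. ennreal ((1 / 2) ^ N))" by (intro suminf_le row) auto
        also have "\<dots> = ennreal 2"
          using geometric_sums[of "1 / 2 :: real"] by (intro suminf_ennreal_eq) auto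
        finally show ?thesis .
      qed
      then have "(SUP \<phi>\<in>dual_ball s (X k). \<Sum>j. ennreal (norm (\<phi> (y k j)) powr p)) \<le> ennreal 2"
        by (rule SUP_least)
      also have "\<dots> < \<infinity>" by simp
      finally have "(SUP \<phi>\<in>dual_ball s (X k). \<Sum>j. ennreal (norm (\<phi> (y k j)) powr p)) < \<infinity>" .
      moreover have "y k j \<in> X k" for j
        unfolding y_def using fX[OF k] by (cases "prod_decode j") (simp only:)
      ultimately show ?thesis unfolding weak_lp_space_def by blast
    qed
    then have "(\<lambda>j. T (\<lambda>k\<in>{1..n}. y k j)) \<in> lp_space (p / n) UNIV" by (rule dom)
    then have fin: "(\<Sum>j. ennreal (norm (T (\<lambda>k\<in>{1..n}. y k j)) powr (p / n))) < \<infinity>" (is "?S < _")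
      by (simp add: lp_space_def)
    define row where "row N = (\<Sum>i. ennreal (norm (T (\<lambda>k\<in>{1..n}. f k (N, i))) powr (p / n)))" for N
    have S: "?S = (\<Sum>N. row N)"
      unfolding y_def
      by (rule suminf_ennreal_2dimen[where f = "\<lambda>z. ennreal (norm (T (\<lambda>k\<in>{1..n}. f k z)) powr (p / n))"])
        (rule row_def)
    have ge: "ennreal (2 ^ N) \<le> ?S" for N
    proof -
      have "(2::real) ^ N = (1 / 2) ^ N * 4 ^ N" by (simp flip: power_mult_distrib)
      also have "\<dots> \<le> (1 / 2) ^ N * Tsum (M N) (x N)" using large[of N] by (intro mult_left_mono) auto
      also have "\<dots> = (\<Sum>i<M N. norm (T (\<lambda>k\<in>{1..n}. c N *\<^sub>R x N k i)) powr (p / n))"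
        unfolding Tsum_def sum_distrib_left cp[symmetric]
        by (intro sum.cong norm_T_scale_all[symmetric] n c0 xX) auto
      also have "\<dots> = (\<Sum>i<M N. norm (T (\<lambda>k\<in>{1..n}. f k (N, i))) powr (p / n))"
        by (rule sum.cong[OF refl]) (simp only: f_in)
      finally have "ennreal (2 ^ N) \<le> ennreal (\<Sum>i<M N. norm (T (\<lambda>k\<in>{1..n}. f k (N, i))) powr (p / n))"
        by (rule ennreal_leI)
      also have "\<dots> = (\<Sum>i<M N. ennreal (norm (T (\<lambda>k\<in>{1..n}. f k (N, i))) powr (p / n)))"
        by (rule sum_ennreal[symmetric]) (rule powr_ge_zero)
      also have "\<dots> \<le> row N"
        unfolding row_def by (rule sum_le_suminf) (rule summableI finite_lessThan zero_le)+
      also have "row N = sum row {N}" by simp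
      also have "\<dots> \<le> ?S"
        unfolding S by (rule sum_le_suminf) (rule summableI finite.intros zero_le)+
      finally show ?thesis .
    qed
    obtain b where b: "?S = ennreal b" "0 \<le> b"
      using fin unfolding infinity_ennreal_def less_top_ennreal by blast
    obtain N where "b < 2 ^ N" using real_arch_pow[of 2 b] by auto
    then show False using ge[of N] b by (simp add: ennreal_le_iff)
  qed
  then obtain D where D: "0 \<le> D" "\<And>M x. ok M x \<Longrightarrow> Tsum M x \<le> D" by blast
  have "dominated_le s p D"
    unfolding dominated_le_def
  proof (intro allI impI)
    fix M :: nat and x and W :: real
    assume W: "0 < W" and xX: "\<forall>k\<in>{1..n}. \<forall>i<M. x k i \<in> X k"
      and weak: "\<forall>k\<in>{1..n}. weak_sum_le s (X k) p {..<M} (x k) W"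
    define t where "t = (1 / W) powr (1 / p)"
    have t: "0 \<le> t" "t powr p = 1 / W" using W p by (simp_all add: t_def powr_powr)
    have "ok M (\<lambda>k i. t *\<^sub>R x k i)"
      unfolding ok_def
    proof (intro ballI conjI allI impI)
      fix k assume k: "k \<in> {1..n}"
      show "t *\<^sub>R x k i \<in> X k" if "i < M" for i using X[OF k] xX k that by (auto intro: subspace_scale)
      have "weak_sum_le s (X k) p {..<M} (\<lambda>i. t *\<^sub>R x k i) (t powr p * W)"
        using k xX weak t(1) by (intro weak_sum_le_scaleR[OF s X[OF k]]) auto
      then show "weak_sum_le s (X k) p {..<M} (\<lambda>i. t *\<^sub>R x k i) 1" using W by (simp add: t(2))
    qed
    then have "Tsum M (\<lambda>k i. t *\<^sub>R x k i) \<le> D" by (rule D(2))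
    also have "Tsum M (\<lambda>k i. t *\<^sub>R x k i) = t powr p * (\<Sum>i<M. norm (T (\<lambda>k\<in>{1..n}. x k i)) powr (p / n))"
      unfolding Tsum_def sum_distrib_left using xX by (intro sum.cong norm_T_scale_all n t(1)) auto
    finally show "(\<Sum>i<M. norm (T (\<lambda>k\<in>{1..n}. x k i)) powr (p / n)) \<le> D * W"
      using W by (simp add: t(2) pos_divide_le_eq)
  qed
  then show ?thesis using D(1) by blast
qed

text \<open>Multiply the \<open>i\<close>-th vectors of all coordinates by the same power \<open>c i\<close> of \<open>\<parallel>T (x\<^sub>i)\<parallel>\<close>, chosen such that
\<open>T\<close> of the new vectors has \<open>p / n\<close>-th powers \<open>\<parallel>T (x\<^sub>i)\<parallel>\<^bsup>q/n\<^esup>\<close>. Hoelder's inequality bounds their weak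
\<open>p\<close>-sums by a power below \<open>1\<close> of the sum \<open>Q\<close> in question, and the resulting inequality is solved for \<open>Q\<close>.\<close>

lemma dominated_le_mono_exponent:
  fixes s :: "'k::real_or_complex \<Rightarrow> 'a \<Rightarrow> 'a"
  assumes s: "normed_space_over s" and n: "1 \<le> n" and pq: "0 < p" "p < q"
    and D: "0 \<le> D" "dominated_le s p D"
  shows "dominated_le s q (D powr (q / p))"
  unfolding dominated_le_def
proof (intro allI impI)
  fix M :: nat and x and W :: real
  assume W: "0 < W" and xX: "\<forall>k\<in>{1..n}. \<forall>i<M. x k i \<in> X k"
    and weak: "\<forall>k\<in>{1..n}. weak_sum_le s (X k) q {..<M} (x k) W"
  define u v where "u = (q - p) / q" and "v = p / q"
  have uv: "0 < u" "0 < v" "u + v = 1" using pq by (auto simp: u_def v_def field_simps)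
  define \<tau> where "\<tau> i = norm (T (\<lambda>k\<in>{1..n}. x k i))" for i
  define Q where "Q = (\<Sum>i<M. \<tau> i powr (q / n))"
  have \<tau>0: "0 \<le> \<tau> i" for i by (simp add: \<tau>_def)
  have Q0: "0 \<le> Q" by (simp add: Q_def sum_nonneg)
  define c where "c i = \<tau> i powr ((q - p) / (n * p))" for i
  have cp: "c i powr p = (\<tau> i powr (q / n)) powr u" for i
    using pq by (simp add: c_def powr_powr u_def)
  show "(\<Sum>i<M. norm (T (\<lambda>k\<in>{1..n}. x k i)) powr (q / n)) \<le> D powr (q / p) * W"
  proof (cases "Q = 0")
    case True
    then show ?thesis using W by (simp add: Q_def \<tau>_def)
  next
    case False
    then have Qpos: "0 < Q" using Q0 by simp
    have weak': "weak_sum_le s (X k) p {..<M} (\<lambda>i. c i *\<^sub>R x k i) (Q powr u * W powr v)" if k: "k \<in> {1..n}" for k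
      unfolding weak_sum_le_def
    proof
      fix \<phi> assume \<phi>: "\<phi> \<in> dual_ball s (X k)"
      have "(\<Sum>i<M. norm (\<phi> (c i *\<^sub>R x k i)) powr p)
          = (\<Sum>i<M. (\<tau> i powr (q / n)) powr u * (norm (\<phi> (x k i)) powr q) powr v)"
      proof (rule sum.cong)
        fix i assume "i \<in> {..<M}"
        then have "norm (\<phi> (c i *\<^sub>R x k i)) = c i * norm (\<phi> (x k i))"
          using xX k by (simp add: dual_ball_scaleR[OF s X[OF k] \<phi>] c_def)
        moreover have "0 \<le> c i" by (simp add: c_def)
        ultimately show "norm (\<phi> (c i *\<^sub>R x k i)) powr p
            = (\<tau> i powr (q / n)) powr u * (norm (\<phi> (x k i)) powr q) powr v"
          using pq by (simp add: powr_mult cp) (simp add: powr_powr v_def)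
      qed simp
      also have "\<dots> \<le> Q powr u * (\<Sum>i<M. norm (\<phi> (x k i)) powr q) powr v"
        unfolding Q_def by (rule sum_powr_mult_le[OF finite_lessThan]) (auto simp: uv)
      also have "\<dots> \<le> Q powr u * W powr v"
        using weak k \<phi> uv by (intro mult_left_mono powr_mono2) (auto simp: weak_sum_le_def sum_nonneg)
      finally show "(\<Sum>i<M. norm (\<phi> (c i *\<^sub>R x k i)) powr p) \<le> Q powr u * W powr v" .
    qed
    have "(\<Sum>i<M. norm (T (\<lambda>k\<in>{1..n}. c i *\<^sub>R x k i)) powr (p / n)) \<le> D * (Q powr u * W powr v)"
    proof (rule D(2)[unfolded dominated_le_def, rule_format])
      show "0 < Q powr u * W powr v" using Qpos W by simp
      show "c i *\<^sub>R x k i \<in> X k" if "k \<in> {1..n}" "i < M" for k i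
        using that xX X by (intro subspace_scale) auto
    qed (rule weak')
    also have "(\<Sum>i<M. norm (T (\<lambda>k\<in>{1..n}. c i *\<^sub>R x k i)) powr (p / n)) = Q"
      unfolding Q_def
    proof (rule sum.cong)
      fix i assume i: "i \<in> {..<M}"
      have "norm (T (\<lambda>k\<in>{1..n}. c i *\<^sub>R x k i)) powr (p / n) = c i powr p * \<tau> i powr (p / n)"
        unfolding \<tau>_def using xX i by (intro norm_T_scale_all n) (auto simp: c_def)
      also have "\<dots> = \<tau> i powr (q / n * u + p / n)"
        by (simp add: cp powr_powr powr_add)
      also have "q / n * u + p / n = q / n" using pq n by (simp add: u_def field_simps)
      finally show "norm (T (\<lambda>k\<in>{1..n}. c i *\<^sub>R x k i)) powr (p / n) = \<tau> i powr (q / n)" .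
    qed simp
    finally have "Q \<le> (D * W powr v) * Q powr u" by (simp only: mult_ac)
    then have "Q \<le> (D * W powr v) powr (1 / v)"
      using D(1) uv by (intro le_powr_of_self_bound[OF Q0 _ uv(2,3)]) auto
    also have "\<dots> = D powr (q / p) * W"
      using D(1) W pq by (simp add: powr_mult powr_powr v_def)
    finally show ?thesis by (simp add: Q_def \<tau>_def)
  qed
qed

section \<open>Multiple summability of dominated operators\<close>

text \<open>The exponent \<open>q = 2 L n\<close> exceeds \<open>p\<close>, is an even integer, so that Khinchine's inequality applies, and
makes \<open>q / n = 2 L\<close> at least \<open>2\<close>, so that \<open>q\<close>-domination controls squares.\<close>

lemma multiple_two_summing:
  fixes s :: "'k::real_or_complex \<Rightarrow> 'a \<Rightarrow> 'a"
  assumes s: "normed_space_over s" and n: "1 \<le> n" and cot: "cotype 2 (UNIV :: 'y set)"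
    and p: "0 < p" and D: "0 \<le> D" "dominated_le s p D"
  shows "\<exists>B>0. \<forall>(m::nat) x. (\<forall>k\<in>{1..n}. (\<forall>i<m. x k i \<in> X k) \<and> weak_sum_le s (X k) 2 {..<m} (x k) 1) \<longrightarrow>
      (\<Sum>i\<in>PiE {1..n} (\<lambda>_. {..<m}). (norm (T (\<lambda>k\<in>{1..n}. x k (i k))))\<^sup>2) \<le> B"
proof -
  obtain C where C: "0 < C" and cotype: "\<And>m (y :: nat \<Rightarrow> 'y). (\<And>i. i < m \<Longrightarrow> y i \<in> UNIV) \<Longrightarrow>
      (\<Sum>i<m. (norm (y i))\<^sup>2) \<le> C / 2 ^ m * (\<Sum>\<epsilon>\<in>signs m. (norm (\<Sum>i<m. \<epsilon> i *\<^sub>R y i))\<^sup>2)"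
    using cot by (rule cotype_2E) blast
  obtain L :: nat where "p < real L" using reals_Archimedean2 by blast
  then have L: "1 \<le> L" using p by (cases L) auto
  define l where "l = L * n"
  have l: "1 \<le> l" using L n by (simp add: l_def)
  define q where "q = real (2 * l)"
  have "real L * 1 \<le> real L * (2 * real n)" using n by (intro mult_left_mono) auto
  then have pq: "p < q" using \<open>p < real L\<close> by (simp add: q_def l_def)
  define D' where "D' = D powr (q / p)"
  have D': "0 \<le> D'" "dominated_le s q D'"
    using dominated_le_mono_exponent[OF s n p pq D] by (auto simp: D'_def)
  define K where "K = 2 ^ l * (2 * khinchine_const l)"
  have K: "0 < K" by (simp add: K_def khinchine_const_def)
  have "(\<Sum>i\<in>PiE {1..n} (\<lambda>_. {..<m}). (norm (T (\<lambda>k\<in>{1..n}. x k (i k))))\<^sup>2) \<le> C ^ n * (1 + D' * K)"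
    if x: "\<And>k i. k \<in> {1..n} \<Longrightarrow> i < m \<Longrightarrow> x k i \<in> X k"
      and weak: "\<And>k. k \<in> {1..n} \<Longrightarrow> weak_sum_le s (X k) 2 {..<m} (x k) 1" for m :: nat and x
  proof -
    define z where "z k \<epsilon> = (\<Sum>i<m. \<epsilon> i *\<^sub>R x k i)" for k and \<epsilon> :: "nat \<Rightarrow> real"
    have z: "z k \<epsilon> \<in> X k" if "k \<in> {1..n}" for k \<epsilon>
      unfolding z_def using x that X[OF that] by (intro subspace_sum subspace_scale) auto
    define P where "P = PiE {1..n} (\<lambda>_. signs m)"
    have P: "finite P" "card P = (2 ^ m) ^ n"
      by (auto simp: P_def card_PiE intro: finite_PiE)
    define \<tau> where "\<tau> e = norm (T (\<lambda>k\<in>{1..n}. z k (e k)))" for e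
    have "(\<Sum>i\<in>PiE {1..n} (\<lambda>_. {..<m}). (norm (T (\<lambda>k\<in>{1..n}. x k (i k))))\<^sup>2)
        \<le> (C / 2 ^ m) ^ card {1..n} * (\<Sum>e\<in>PiE {1..n} (\<lambda>_. signs m). (norm (T (\<lambda>k\<in>{1..n}. z k (e k))))\<^sup>2)"
    proof (rule sum_PiE_coordinatewise_le[where X = X and v = "\<lambda>k\<in>{1..n}. 0"])
      show "(\<lambda>k\<in>{1..n}. 0) \<in> PiE {1..n} X" using X by (auto simp: subspace_0)
      show "(\<Sum>i<m. (norm (T (v(k := x k i))))\<^sup>2)
          \<le> C / 2 ^ m * (\<Sum>e\<in>signs m. (norm (T (v(k := z k e))))\<^sup>2)"
        if k: "k \<in> {1..n}" and v: "v \<in> PiE {1..n} X" for k v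
      proof -
        have "T (v(k := z k e)) = (\<Sum>i<m. e i *\<^sub>R T (v(k := x k i)))" for e
          unfolding z_def using x[OF k] by (intro T_sum[OF v k]) auto
        then show ?thesis using cotype[of m "\<lambda>i. T (v(k := x k i))"] by simp
      qed
    qed (use C x z in auto)
    also have "\<dots> = (C / 2 ^ m) ^ n * (\<Sum>e\<in>P. (\<tau> e)\<^sup>2)"
      unfolding P_def \<tau>_def by simp
    also have "\<dots> \<le> (C / 2 ^ m) ^ n * (\<Sum>e\<in>P. 1 + \<tau> e powr (q / n))"
    proof (intro mult_left_mono sum_mono)
      fix e
      have "\<tau> e powr (q / n) = \<tau> e ^ (2 * L)"
        using n L powr_realpow'[of "\<tau> e" "2 * L"] by (simp add: q_def l_def \<tau>_def)
      also have "\<dots> = ((\<tau> e)\<^sup>2) ^ L" by (simp add: power_mult)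
      finally have pw: "\<tau> e powr (q / n) = ((\<tau> e)\<^sup>2) ^ L" .
      show "(\<tau> e)\<^sup>2 \<le> 1 + \<tau> e powr (q / n)"
      proof (cases "1 \<le> (\<tau> e)\<^sup>2")
        case True
        then have "((\<tau> e)\<^sup>2) ^ 1 \<le> ((\<tau> e)\<^sup>2) ^ L" using L by (intro power_increasing) auto
        then show ?thesis by (simp add: pw)
      next
        case False
        then show ?thesis by (simp add: add_increasing2)
      qed
    qed (use C in auto)
    also have "\<dots> = (C / 2 ^ m) ^ n * ((2 ^ m) ^ n + (\<Sum>e\<in>P. \<tau> e powr (q / n)))"
      by (simp add: sum.distrib P(2))
    also have "\<dots> \<le> (C / 2 ^ m) ^ n * ((2 ^ m) ^ n + D' * (K * (2 ^ m) ^ n))"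
    proof (intro mult_left_mono add_left_mono)
      obtain h where h: "bij_betw h {..<card P} P"
        using ex_bij_betw_nat_finite[OF P(1)] by (auto simp: atLeast0LessThan)
      have weak_z: "weak_sum_le s (X k) q {..<card P} (\<lambda>i. z k (h i k)) (K * (2 ^ m) ^ n)" if k: "k \<in> {1..n}" for k
        unfolding weak_sum_le_def
      proof
        fix \<phi> assume \<phi>: "\<phi> \<in> dual_ball s (X k)"
        have \<phi>z: "\<phi> (z k e) = (\<Sum>i<m. e i *\<^sub>R \<phi> (x k i))" for e
          unfolding z_def using x[OF k] by (intro dual_ball_sum[OF s X[OF k] \<phi>]) auto
        have "(\<Sum>i<card P. norm (\<phi> (z k (h i k))) powr q) = (\<Sum>e\<in>P. norm (\<phi> (z k (e k))) powr q)"
          by (rule sum.reindex_bij_betw[OF h, of "\<lambda>e. norm (\<phi> (z k (e k))) powr q"])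
        also have "\<dots> = real (card (signs m)) ^ (card {1..n} - 1) * (\<Sum>e\<in>signs m. norm (\<phi> (z k e)) powr q)"
          unfolding P_def by (rule sum_PiE_one_coordinate) (use k in auto)
        also have "\<dots> = (2 ^ m) ^ (n - 1) * (\<Sum>e\<in>signs m. norm (\<Sum>i<m. e i *\<^sub>R \<phi> (x k i)) ^ (2 * l))"
          using l powr_realpow'[of _ "2 * l"] by (simp add: \<phi>z q_def)
        also have "\<dots> \<le> (2 ^ m) ^ (n - 1) * (K * 2 ^ m)"
          unfolding K_def using weak[OF k] \<phi> l
          by (intro mult_left_mono khinchine_scalar) (auto simp: weak_sum_le_def)
        also have "\<dots> = K * (2 ^ m) ^ n" using n by (cases n) auto
        finally show "(\<Sum>i<card P. norm (\<phi> (z k (h i k))) powr q) \<le> K * (2 ^ m) ^ n" .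
      qed
      have "(\<Sum>i<card P. norm (T (\<lambda>k\<in>{1..n}. z k (h i k))) powr (q / n)) \<le> D' * (K * (2 ^ m) ^ n)"
      proof (rule D'(2)[unfolded dominated_le_def, rule_format])
        show "0 < K * (2 ^ m) ^ n" using K by simp
      qed (rule z weak_z, assumption)+
      moreover have "(\<Sum>i<card P. norm (T (\<lambda>k\<in>{1..n}. z k (h i k))) powr (q / n)) = (\<Sum>e\<in>P. \<tau> e powr (q / n))"
        unfolding \<tau>_def by (rule sum.reindex_bij_betw[OF h, of "\<lambda>e. norm (T (\<lambda>k\<in>{1..n}. z k (e k))) powr (q / n)"])
      ultimately show "(\<Sum>e\<in>P. \<tau> e powr (q / n)) \<le> D' * (K * (2 ^ m) ^ n)" by simp
    qed (use C in auto)
    also have "\<dots> = C ^ n * (1 + D' * K)"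
      by (simp add: power_divide field_simps)
    finally show ?thesis .
  qed
  moreover have "0 < C ^ n * (1 + D' * K)" using C D' K by (intro mult_pos_pos add_pos_nonneg) auto
  ultimately show ?thesis by (intro exI[of _ "C ^ n * (1 + D' * K)"]) blast
qed

text \<open>Here \<open>N a\<close> is the \<open>\<ell>\<^sub>2\<close> norm of the values of \<open>T\<close> with \<open>a\<close> in coordinate \<open>j\<close> and all choices of members
of the given families in the other coordinates. It is \<open>2\<close>-summing by multiple summability, and its value at
\<open>x j i\<close> dominates the diagonal term \<open>i\<close>.\<close>

lemma r_summing_of_multiple_two_summing:
  fixes s :: "'k::real_or_complex \<Rightarrow> 'a \<Rightarrow> 'a"
  assumes s: "normed_space_over s" and j: "j \<in> {1..n}" and cot: "cotype 2 (X j)"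
    and r: "1 \<le> r" "r \<le> 2" and B0: "0 < B"
    and B: "\<And>(m::nat) x. (\<And>k i. k \<in> {1..n} \<Longrightarrow> i < m \<Longrightarrow> x k i \<in> X k) \<Longrightarrow>
      (\<And>k. k \<in> {1..n} \<Longrightarrow> weak_sum_le s (X k) 2 {..<m} (x k) 1) \<Longrightarrow>
      (\<Sum>i\<in>PiE {1..n} (\<lambda>_. {..<m}). (norm (T (\<lambda>k\<in>{1..n}. x k (i k))))\<^sup>2) \<le> B"
  shows "\<exists>B'. \<forall>(m::nat) x. (\<forall>k\<in>{1..n}. (\<forall>i<m. x k i \<in> X k) \<and> weak_sum_le s (X k) r {..<m} (x k) 1) \<longrightarrow>
      (\<Sum>i<m. norm (T (\<lambda>k\<in>{1..n}. x k i)) powr r) \<le> B'"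
proof -
  obtain B' where B': "\<forall>(m::nat) N y. (\<forall>x. 0 \<le> N x) \<longrightarrow> (\<forall>t. \<forall>x\<in>X j. N (t *\<^sub>R x) = \<bar>t\<bar> * N x) \<longrightarrow>
      (\<forall>y W. (\<forall>i<m. y i \<in> X j) \<longrightarrow> weak_sum_le s (X j) 2 {..<m} y W \<longrightarrow> (\<Sum>i<m. (N (y i))\<^sup>2) \<le> B * W) \<longrightarrow>
      (\<forall>i<m. y i \<in> X j) \<longrightarrow> weak_sum_le s (X j) r {..<m} y 1 \<longrightarrow> (\<Sum>i<m. N (y i) powr r) \<le> B'"
    using r_summing_of_two_summing[OF s X[OF j] cot r(1) less_imp_le[OF B0]] by (rule exE)
  have main: "(\<Sum>i<m. norm (T (\<lambda>k\<in>{1..n}. x k i)) powr r) \<le> B'"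
    if x: "\<And>k i. k \<in> {1..n} \<Longrightarrow> i < m \<Longrightarrow> x k i \<in> X k"
      and weak: "\<And>k. k \<in> {1..n} \<Longrightarrow> weak_sum_le s (X k) r {..<m} (x k) 1" for m :: nat and x
  proof -
    have weak2: "weak_sum_le s (X k) 2 {..<m} (x k) 1" if k: "k \<in> {1..n}" for k
      unfolding weak_sum_le_def
    proof
      fix \<phi> assume "\<phi> \<in> dual_ball s (X k)"
      then have le1: "(\<Sum>i<m. norm (\<phi> (x k i)) powr r) \<le> 1" using weak[OF k] by (auto simp: weak_sum_le_def)
      have "norm (\<phi> (x k i)) powr 2 \<le> norm (\<phi> (x k i)) powr r" if i: "i < m" for i
      proof -
        have "norm (\<phi> (x k i)) powr r \<le> (\<Sum>i<m. norm (\<phi> (x k i)) powr r)"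
          using i by (intro member_le_sum) auto
        then have "norm (\<phi> (x k i)) \<le> 1"
          using le1 r(1) gr_one_powr[of "norm (\<phi> (x k i))" r] by linarith
        then show ?thesis using r(2) by (intro powr_mono') auto
      qed
      then have "(\<Sum>i<m. norm (\<phi> (x k i)) powr 2) \<le> (\<Sum>i<m. norm (\<phi> (x k i)) powr r)"
        by (intro sum_mono) auto
      then show "(\<Sum>i<m. norm (\<phi> (x k i)) powr 2) \<le> 1" using le1 by linarith
    qed
    define J where "J = {1..n} - {j}"
    have J: "insert j J = {1..n}" "j \<notin> J" using j by (auto simp: J_def)
    define V where "V a i = (\<lambda>k\<in>{1..n}. if k = j then a else x k (i k))" for a and i :: "nat \<Rightarrow> nat"
    define N where "N a = sqrt (\<Sum>i\<in>PiE J (\<lambda>_. {..<m}). (norm (T (V a i)))\<^sup>2)" for a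
    have N2: "(N a)\<^sup>2 = (\<Sum>i\<in>PiE J (\<lambda>_. {..<m}). (norm (T (V a i)))\<^sup>2)" for a
      unfolding N_def by (simp add: sum_nonneg)
    have N0: "0 \<le> N a" for a unfolding N_def by (simp add: sum_nonneg)
    have hom: "N (t *\<^sub>R a) = \<bar>t\<bar> * N a" if a: "a \<in> X j" for t a
    proof -
      have "norm (T (V (t *\<^sub>R a) i)) = \<bar>t\<bar> * norm (T (V a i))" if i: "i \<in> PiE J (\<lambda>_. {..<m})" for i
      proof -
        have "V a i \<in> PiE {1..n} X" using i a x J by (auto simp: V_def J_def PiE_iff)
        from T_scale[OF this j a, of t]
        have "T ((V a i)(j := t *\<^sub>R a)) = t *\<^sub>R T ((V a i)(j := a))" .
        moreover have "(V a i)(j := b) = V b i" for b using j by (auto simp: V_def fun_eq_iff)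
        ultimately show ?thesis by (simp only: norm_scaleR)
      qed
      then have "(N (t *\<^sub>R a))\<^sup>2 = (\<bar>t\<bar> * N a)\<^sup>2"
        by (simp add: N2 power_mult_distrib sum_distrib_left)
      then show ?thesis using N0 by (simp add: power2_eq_iff_nonneg)
    qed
    have unit: "(\<Sum>l<m. (N (y l))\<^sup>2) \<le> B"
      if y: "\<And>i. i < m \<Longrightarrow> y i \<in> X j" and wy: "weak_sum_le s (X j) 2 {..<m} y 1" for y
    proof -
      have V: "V (y l) i = (\<lambda>k\<in>{1..n}. (x(j := y)) k ((i(j := l)) k))" for l i
        by (auto simp: V_def)
      have "(\<Sum>l<m. (N (y l))\<^sup>2)
          = (\<Sum>i\<in>PiE (insert j J) (\<lambda>_. {..<m}). (norm (T (\<lambda>k\<in>{1..n}. (x(j := y)) k (i k))))\<^sup>2)"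
        unfolding N2 sum_PiE_insert[OF J(2)] V by (rule sum.swap)
      also have "\<dots> \<le> B"
        unfolding J(1)
      proof (rule B)
        fix k assume k: "k \<in> {1..n}"
        show "(x(j := y)) k i \<in> X k" if "i < m" for i
          using x[OF k that] y[OF that] by (cases "k = j") simp_all
        show "weak_sum_le s (X k) 2 {..<m} ((x(j := y)) k) 1"
          using weak2[OF k] wy by (cases "k = j") simp_all
      qed
      finally show ?thesis .
    qed
    have two: "(\<Sum>l<m. (N (y l))\<^sup>2) \<le> B * W"
      if y: "\<And>i. i < m \<Longrightarrow> y i \<in> X j" and wy: "weak_sum_le s (X j) 2 {..<m} y W" for y W
      (* W may vanish, so the family is normalised with a slightly larger weak bound. *)
    proof (rule field_le_epsilon)
      fix e :: real assume e: "0 < e"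
      define w where "w = W + e / B"
      have w: "0 < w" using weak_sum_le_nonneg[OF wy] e B0 by (simp add: w_def add_nonneg_pos)
      define t where "t = 1 / sqrt w"
      have t: "0 \<le> t" "t\<^sup>2 = 1 / w" using w by (auto simp: t_def power_divide)
      have "weak_sum_le s (X j) 2 {..<m} y w"
        unfolding weak_sum_le_def
      proof
        fix \<phi> assume "\<phi> \<in> dual_ball s (X j)"
        then have "(\<Sum>i<m. norm (\<phi> (y i)) powr 2) \<le> W" using wy unfolding weak_sum_le_def by blast
        also have "W \<le> w" using e B0 by (simp add: w_def)
        finally show "(\<Sum>i<m. norm (\<phi> (y i)) powr 2) \<le> w" .
      qed
      from weak_sum_le_scaleR[OF s X[OF j] _ this t(1)]
      have "weak_sum_le s (X j) 2 {..<m} (\<lambda>i. t *\<^sub>R y i) 1" using y t w by simp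
      then have "(\<Sum>l<m. (N (t *\<^sub>R y l))\<^sup>2) \<le> B"
        using y X[OF j] by (intro unit) (auto intro: subspace_scale)
      moreover have "(\<Sum>l<m. (N (t *\<^sub>R y l))\<^sup>2) = t\<^sup>2 * (\<Sum>l<m. (N (y l))\<^sup>2)"
        by (simp add: hom y power_mult_distrib sum_distrib_left)
      ultimately have "(\<Sum>l<m. (N (y l))\<^sup>2) \<le> B * w"
        using w by (simp add: t(2) pos_divide_le_eq)
      also have "\<dots> = B * W + e" using B0 by (simp add: w_def field_simps)
      finally show "(\<Sum>l<m. (N (y l))\<^sup>2) \<le> B * W + e" .
    qed
    have total: "(\<Sum>i<m. N (x j i) powr r) \<le> B'"
      by (rule B'[THEN spec[of _ m], THEN spec[of _ N], THEN spec[of _ "x j"], rule_format])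
        (fact N0 | fact hom | fact two | fact x[OF j] | fact weak[OF j])+
    have le: "norm (T (\<lambda>k\<in>{1..n}. x k i)) \<le> N (x j i)" if i: "i < m" for i
    proof -
      have eq: "(\<lambda>k\<in>{1..n}. x k i) = V (x j i) (\<lambda>k\<in>J. i)"
        unfolding V_def by (rule restrict_ext) (simp add: J_def)
      have "(norm (T (V (x j i) (\<lambda>k\<in>J. i))))\<^sup>2 \<le> (N (x j i))\<^sup>2"
        unfolding N2
      proof (rule member_le_sum)
        show "(\<lambda>k\<in>J. i) \<in> PiE J (\<lambda>_. {..<m})" using i by (simp add: PiE_iff)
        show "finite (PiE J (\<lambda>_. {..<m}))" by (rule finite_PiE) (simp_all add: J_def)
      qed (rule zero_le_power2)
      then show ?thesis unfolding eq by (rule power2_le_imp_le) (rule N0)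
    qed
    have "(\<Sum>i<m. norm (T (\<lambda>k\<in>{1..n}. x k i)) powr r) \<le> (\<Sum>i<m. N (x j i) powr r)"
    proof (rule sum_mono)
      fix i assume "i \<in> {..<m}"
      then show "norm (T (\<lambda>k\<in>{1..n}. x k i)) powr r \<le> N (x j i) powr r"
        using r(1) le[of i] by (intro powr_mono2) simp_all
    qed
    then show ?thesis by (rule order_trans) (rule total)
  qed
  show ?thesis
    by (intro exI[of _ B'] allI impI main) simp_all
qed

end

section \<open>Composition with bounded operators\<close>

lemma weak_lp_space_imp_weak_sum_le:
  assumes "x \<in> weak_lp_space p s S"
  shows "\<exists>W. \<forall>m. weak_sum_le s S p {..<m::nat} x W"
proof -
  have "(SUP \<phi>\<in>dual_ball s S. \<Sum>j. ennreal (norm (\<phi> (x j)) powr p)) < \<infinity>"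
    using assms unfolding weak_lp_space_def by blast
  then obtain W where W: "(SUP \<phi>\<in>dual_ball s S. \<Sum>j. ennreal (norm (\<phi> (x j)) powr p)) = ennreal W" "0 \<le> W"
    unfolding infinity_ennreal_def less_top_ennreal by blast
  have "weak_sum_le s S p {..<m} x W" for m
    unfolding weak_sum_le_def
  proof
    fix \<phi> assume \<phi>: "\<phi> \<in> dual_ball s S"
    have "ennreal (\<Sum>i<m. norm (\<phi> (x i)) powr p) = (\<Sum>i<m. ennreal (norm (\<phi> (x i)) powr p))"
      by (rule sum_ennreal[symmetric]) (rule powr_ge_zero)
    also have "\<dots> \<le> (\<Sum>j. ennreal (norm (\<phi> (x j)) powr p))"
      by (rule sum_le_suminf) (rule summableI finite_lessThan zero_le)+
    also have "\<dots> \<le> ennreal W"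
      unfolding W(1)[symmetric] by (rule SUP_upper[OF \<phi>])
    finally show "(\<Sum>i<m. norm (\<phi> (x i)) powr p) \<le> W"
      using W(2) by (simp add: ennreal_le_iff)
  qed
  then show ?thesis by blast
qed

lemma lp_space_UNIV_I:
  assumes "\<And>m. (\<Sum>j<m. norm (x j) powr p) \<le> B"
  shows "x \<in> lp_space p UNIV"
proof -
  have "(\<Sum>j. ennreal (norm (x j) powr p)) \<le> ennreal B"
    unfolding suminf_eq_SUP
  proof (rule SUP_least)
    fix m
    have "(\<Sum>j<m. ennreal (norm (x j) powr p)) = ennreal (\<Sum>j<m. norm (x j) powr p)"
      by (rule sum_ennreal) (rule powr_ge_zero)
    also have "\<dots> \<le> ennreal B" by (rule ennreal_leI) (rule assms)
    finally show "(\<Sum>j<m. ennreal (norm (x j) powr p)) \<le> ennreal B" .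
  qed
  also have "\<dots> < \<infinity>" by simp
  finally show ?thesis by (simp add: lp_space_def)
qed

lemma summing_linear_bounded:
  assumes sY: "normed_space_over sY" and sZ: "normed_space_over sZ" and u: "u \<in> summing_linear q sY sZ"
  shows "\<exists>K\<ge>0. \<forall>y. norm (u y) \<le> K * norm y"
proof -
  interpret Y: normed_space_over sY by fact
  interpret Z: normed_space_over sZ by fact
  interpret u: Vector_Spaces.linear sY sZ u using u by (simp add: summing_linear_def)
  have scale: "u (t *\<^sub>R y) = t *\<^sub>R u y" for t y
    using u.scale[of "of_real t" y] by (simp add: Y.scale_of_real Z.scale_of_real)
  have "continuous_on UNIV u" using u by (simp add: summing_linear_def)
  then obtain d where d: "0 < d" "\<And>y. dist y 0 < d \<Longrightarrow> dist (u y) (u 0) < 1"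
    unfolding continuous_on_iff by (metis UNIV_I zero_less_one)
  have "norm (u y) \<le> (2 / d) * norm y" for y
  proof (cases "y = 0")
    case False
    define t where "t = d / (2 * norm y)"
    have t: "0 < t" using d(1) False by (simp add: t_def)
    have "norm (t *\<^sub>R y) < d" using d(1) False by (simp add: t_def)
    then have "norm (u (t *\<^sub>R y)) < 1" using d(2)[of "t *\<^sub>R y"] by (simp add: u.zero)
    then have "t * norm (u y) < 1" using t by (simp add: scale)
    then have "norm (u y) < 1 / t" using t by (simp add: field_simps)
    then show ?thesis by (simp add: t_def)
  qed (simp add: u.zero)
  then show ?thesis using d(1) by (intro exI[of _ "2 / d"]) simp
qed

lemma multilinear_operator_comp:
  assumes T: "multilinear_operator n sX X sY T" and u: "u \<in> summing_linear q sY sZ"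
  shows "multilinear_operator n sX X sZ (u \<circ> T)"
proof -
  interpret u: Vector_Spaces.linear sY sZ u using u by (simp add: summing_linear_def)
  have "continuous_on UNIV u" using u by (simp add: summing_linear_def)
  then have "continuous_on (PiE {1..n} X) (u \<circ> T)"
    using T unfolding multilinear_operator_def by (meson continuous_on_compose continuous_on_subset subset_UNIV)
  then show ?thesis
    using T unfolding multilinear_operator_def by (simp add: u.add u.scale)
qed

lemma multilinear_operator_real:
  assumes sX: "normed_space_over sX" and sY: "normed_space_over sY"
    and X: "\<And>k. k \<in> {1..n} \<Longrightarrow> banach_subspace sX (X k)"
    and T: "multilinear_operator n sX X sY T"
  shows "real_multilinear n X T"
proof
  interpret SX: normed_space_over sX by fact
  interpret SY: normed_space_over sY by fact
  show "Real_Vector_Spaces.subspace (X k)" if "k \<in> {1..n}" for k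
  proof -
    have "SX.subspace (X k)" using X[OF that] by (simp add: banach_subspace_def)
    then show ?thesis
      unfolding Real_Vector_Spaces.subspace_def SX.subspace_def by (metis SX.scale_of_real)
  qed
  fix x k a assume x: "x \<in> PiE {1..n} X" "k \<in> {1..n}" "a \<in> X k"
  show "T (x(k := a + b)) = T (x(k := a)) + T (x(k := b))" if "b \<in> X k" for b
    using T x that unfolding multilinear_operator_def by blast
  have "T (x(k := sX (of_real t) a)) = sY (of_real t) (T (x(k := a)))" for t
    using T x unfolding multilinear_operator_def by blast
  then show "T (x(k := t *\<^sub>R a)) = t *\<^sub>R T (x(k := a))" for t
    by (simp only: SX.scale_of_real SY.scale_of_real)
qed

theorem corollary4p8:
  fixes n j :: nat and q r :: real
    and sX :: "'k::real_or_complex \<Rightarrow> 'a::banach \<Rightarrow> 'a"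
    and sY :: "'k \<Rightarrow> 'y::banach \<Rightarrow> 'y"
    and sZ :: "'k \<Rightarrow> 'z::banach \<Rightarrow> 'z"
    and X :: "nat \<Rightarrow> 'a set"
  assumes "n \<ge> 1" and "j \<in> {1..n}"
    and "normed_space_over sX" and "normed_space_over sY" and "normed_space_over sZ"
    and "\<And>k. k \<in> {1..n} \<Longrightarrow> banach_subspace sX (X k)"
    and "cotype 2 (X j)" and "cotype 2 (UNIV :: 'y set)"
    and "1 \<le> q" and "1 \<le> r" and "r \<le> 2"
  shows "compose_classes (summing_linear q sY sZ) (\<Union>p\<in>{1..}. dominated_multilinear n p sX X sY)
           \<subseteq> r_summing_multilinear n r sX X sZ"
proof
  fix R assume "R \<in> compose_classes (summing_linear q sY sZ) (\<Union>p\<in>{1..}. dominated_multilinear n p sX X sY)"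
  then obtain u T p where R: "R = u \<circ> T" and u: "u \<in> summing_linear q sY sZ" and p: "1 \<le> p"
    and T: "T \<in> dominated_multilinear n p sX X sY"
    unfolding compose_classes_def by blast
  have Tm: "multilinear_operator n sX X sY T"
    and dom: "\<And>x. (\<And>k. k \<in> {1..n} \<Longrightarrow> x k \<in> weak_lp_space p sX (X k)) \<Longrightarrow>
      (\<lambda>j. T (\<lambda>k\<in>{1..n}. x k j)) \<in> lp_space (p / n) UNIV"
    using T unfolding dominated_multilinear_def summing_multilinear_def by blast+
  interpret real_multilinear n X T
    by (rule multilinear_operator_real[OF assms(3,4,6) Tm])
  have p0: "0 < p" using p by simp
  obtain D where D: "0 \<le> D" "dominated_le sX p D"
    using dominated_le_uniform[OF assms(3,1) p0 dom] by blast
  obtain B where B: "0 < B" "\<forall>(m::nat) x. (\<forall>k\<in>{1..n}. (\<forall>i<m. x k i \<in> X k) \<and> weak_sum_le sX (X k) 2 {..<m} (x k) 1) \<longrightarrow>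
      (\<Sum>i\<in>PiE {1..n} (\<lambda>_. {..<m}). (norm (T (\<lambda>k\<in>{1..n}. x k (i k))))\<^sup>2) \<le> B"
    using multiple_two_summing[OF assms(3,1,8) p0 D] by blast
  have B2: "(\<Sum>i\<in>PiE {1..n} (\<lambda>_. {..<m}). (norm (T (\<lambda>k\<in>{1..n}. x k (i k))))\<^sup>2) \<le> B"
    if "\<And>k i. k \<in> {1..n} \<Longrightarrow> i < m \<Longrightarrow> x k i \<in> X k"
      "\<And>k. k \<in> {1..n} \<Longrightarrow> weak_sum_le sX (X k) 2 {..<m} (x k) 1" for m :: nat and x
    using that by (intro B(2)[rule_format]) simp
  obtain B' where B': "\<forall>(m::nat) x. (\<forall>k\<in>{1..n}. (\<forall>i<m. x k i \<in> X k) \<and> weak_sum_le sX (X k) r {..<m} (x k) 1) \<longrightarrow>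
      (\<Sum>i<m. norm (T (\<lambda>k\<in>{1..n}. x k i)) powr r) \<le> B'"
    using r_summing_of_multiple_two_summing[OF assms(3,2,7,10,11) B(1) B2] by (rule exE)
  obtain K where K: "0 \<le> K" "\<And>y. norm (u y) \<le> K * norm y"
    using summing_linear_bounded[OF assms(4,5) u] by blast
  have "(\<lambda>i. R (\<lambda>k\<in>{1..n}. x k i)) \<in> lp_space r UNIV"
    if x: "\<And>k. k \<in> {1..n} \<Longrightarrow> x k \<in> weak_lp_space r sX (X k)" for x
  proof -
    have xX: "x k i \<in> X k" if "k \<in> {1..n}" for k i
      using x[OF that] unfolding weak_lp_space_def by blast
    have "\<forall>k\<in>{1..n}. \<exists>W. \<forall>m::nat. weak_sum_le sX (X k) r {..<m} (x k) W"
      using weak_lp_space_imp_weak_sum_le[OF x] by blast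
    then obtain W where W: "\<And>k m. k \<in> {1..n} \<Longrightarrow> weak_sum_le sX (X k) r {..<m::nat} (x k) (W k)"
      by metis
    have W0: "0 \<le> W k" if "k \<in> {1..n}" for k
      using weak_sum_le_nonneg[OF W[OF that, of 0]] .
    define w where "w = 1 + (\<Sum>k\<in>{1..n}. W k)"
    have w: "0 < w" using sum_nonneg[of "{1..n}" W] W0 by (simp add: w_def add_pos_nonneg)
    have Ww: "W k \<le> w" if "k \<in> {1..n}" for k
      using member_le_sum[OF that, of W] W0 by (simp add: w_def)
    (* A common scaling of all coordinates that normalises the weak r-sums. *)
    define t where "t = (1 / w) powr (1 / r)"
    have t: "0 < t" "t powr r = 1 / w" using w assms(10) by (simp_all add: t_def powr_powr)
    have "(\<Sum>i<m. norm (R (\<lambda>k\<in>{1..n}. x k i)) powr r) \<le> K powr r * (B' / t powr (n * r))" for m :: nat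
    proof -
      have "weak_sum_le sX (X k) r {..<m} (\<lambda>i. t *\<^sub>R x k i) 1" if k: "k \<in> {1..n}" for k
      proof -
        have "weak_sum_le sX (X k) r {..<m} (\<lambda>i. t *\<^sub>R x k i) (t powr r * W k)"
          using t(1) by (intro weak_sum_le_scaleR[OF assms(3) X[OF k] _ W[OF k]] xX k) simp
        moreover have "t powr r * W k \<le> 1" using Ww[OF k] w by (simp add: t(2) field_simps)
        ultimately show ?thesis unfolding weak_sum_le_def by (meson order_trans)
      qed
      then have "(\<Sum>i<m. norm (T (\<lambda>k\<in>{1..n}. t *\<^sub>R x k i)) powr r) \<le> B'"
        using X xX by (intro B'[rule_format, where x = "\<lambda>k i. t *\<^sub>R x k i"]) (simp add: subspace_scale)
      moreover have "norm (T (\<lambda>k\<in>{1..n}. t *\<^sub>R x k i)) powr r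
          = t powr (n * r) * norm (T (\<lambda>k\<in>{1..n}. x k i)) powr r" for i
        using norm_T_scale_all[OF assms(1), of "\<lambda>k. x k i" t "n * r"] xX t(1) assms(1) by simp
      ultimately have "t powr (n * r) * (\<Sum>i<m. norm (T (\<lambda>k\<in>{1..n}. x k i)) powr r) \<le> B'"
        by (simp add: sum_distrib_left)
      then have T_le: "(\<Sum>i<m. norm (T (\<lambda>k\<in>{1..n}. x k i)) powr r) \<le> B' / t powr (n * r)"
        using t(1) by (simp add: pos_le_divide_eq mult.commute)
      have "(\<Sum>i<m. norm (R (\<lambda>k\<in>{1..n}. x k i)) powr r)
          \<le> (\<Sum>i<m. K powr r * norm (T (\<lambda>k\<in>{1..n}. x k i)) powr r)"
      proof (rule sum_mono)
        fix i
        have "norm (R (\<lambda>k\<in>{1..n}. x k i)) powr r \<le> (K * norm (T (\<lambda>k\<in>{1..n}. x k i))) powr r"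
          unfolding R o_def using assms(10) by (intro powr_mono2 K(2)) auto
        also have "\<dots> = K powr r * norm (T (\<lambda>k\<in>{1..n}. x k i)) powr r"
          using K(1) by (simp add: powr_mult)
        finally show "norm (R (\<lambda>k\<in>{1..n}. x k i)) powr r \<le> K powr r * norm (T (\<lambda>k\<in>{1..n}. x k i)) powr r" .
      qed
      also have "\<dots> \<le> K powr r * (B' / t powr (n * r))"
        unfolding sum_distrib_left[symmetric] by (rule mult_left_mono[OF T_le]) simp
      finally show ?thesis .
    qed
    then show ?thesis by (rule lp_space_UNIV_I)
  qed
  then show "R \<in> r_summing_multilinear n r sX X sZ"
    unfolding r_summing_multilinear_def summing_multilinear_def
    using multilinear_operator_comp[OF Tm u] by (simp add: R)
qed

end
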